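(* Let $d\ge2$, let $D=\{x\in\mathbb R^d:x_1>0\}$, $e_1=(1,0,\dots,0)$, and let $B$ be the open ball in $\mathbb R^d$ with center $e_1$ and radius $1$. Then $$\lim_{s\to0}\ \limsup_{\lambda\to0}\ \widetilde W^D_{\lambda e_1,1}(\tau_B\le s)=0,$$ where $s>0$ and $\lambda>0$.
   Context: $\mathcal C_\infty$ is the space of continuous functions $w:[0,\infty)\to\mathbb R^d$ with its Borel $\sigma$-algebra (topology of uniform convergence on compact sets); $X_t(w)=w(t)$; $W_x$ is the law on $\mathcal C_\infty$ of standard $d$-dimensional Brownian motion started at $x$. For an open set $U\subset\mathbb R^d$, $\tau_U=\inf\{t>0:X_t\notin U\}$, and for $x\in U$, $\widetilde W^U_{x,1}(\cdot)=W_x(\cdot\mid\tau_U>1)$. *)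

theory Defs
  imports "HOL-Probability.Probability"
begin

text \<open>Paths are functions on all of \<^typ>\<open>real\<close> that are continuous on \<open>[0,\<infinity>)\<close>; membership in
  \<open>extensional\<close> fixes the irrelevant values at negative times, so that elements of the set
  correspond one-to-one to continuous functions \<open>[0,\<infinity>) \<rightarrow> 'a\<close>.\<close>

definition path_space :: "(real \<Rightarrow> 'a::metric_space) set" where
  "path_space = {w. continuous_on {0..} w \<and> w \<in> extensional {0..}}"

text \<open>Topology of uniform convergence on compact subsets of \<open>[0,\<infinity>)\<close>.\<close>

definition path_open :: "(real \<Rightarrow> 'a::metric_space) set \<Rightarrow> bool" where
  "path_open U \<longleftrightarrow> U \<subseteq> path_space \<and>
     (\<forall>w\<in>U. \<exists>K e. compact K \<and> K \<subseteq> {0..} \<and> e > 0 \<and>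
        {v \<in> path_space. \<forall>t\<in>K. dist (v t) (w t) < e} \<subseteq> U)"

definition path_topology :: "(real \<Rightarrow> 'a::metric_space) topology" where
  "path_topology = topology path_open"

lemma istopology_path_open: "istopology (path_open :: (real \<Rightarrow> 'a::metric_space) set \<Rightarrow> bool)"
  unfolding istopology_def
proof (intro conjI allI impI)
  fix S T :: "(real \<Rightarrow> 'a) set"
  assume S: "path_open S" and T: "path_open T"
  show "path_open (S \<inter> T)"
    unfolding path_open_def
  proof (intro conjI ballI)
    show "S \<inter> T \<subseteq> path_space" using S by (auto simp: path_open_def)
    fix w assume w: "w \<in> S \<inter> T"
    obtain K e where K: "compact K" "K \<subseteq> {0..}" "e > 0"
      "{v \<in> path_space. \<forall>t\<in>K. dist (v t) (w t) < e} \<subseteq> S"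
      using S w unfolding path_open_def by (meson IntD1)
    obtain L f where L: "compact L" "L \<subseteq> {0..}" "f > 0"
      "{v \<in> path_space. \<forall>t\<in>L. dist (v t) (w t) < f} \<subseteq> T"
      using T w unfolding path_open_def by (meson IntD2)
    show "\<exists>K e. compact K \<and> K \<subseteq> {0..} \<and> e > 0 \<and>
        {v \<in> path_space. \<forall>t\<in>K. dist (v t) (w t) < e} \<subseteq> S \<inter> T"
      by (rule exI[of _ "K \<union> L"], rule exI[of _ "min e f"]) (use K L in auto)
  qed
next
  fix \<K> :: "(real \<Rightarrow> 'a) set set"
  assume *: "\<forall>U\<in>\<K>. path_open U"
  show "path_open (\<Union>\<K>)"
    unfolding path_open_def
  proof (intro conjI ballI)
    show "\<Union>\<K> \<subseteq> path_space" using * by (auto simp: path_open_def)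
    fix w assume "w \<in> \<Union>\<K>"
    then obtain U where U: "U \<in> \<K>" "w \<in> U" by auto
    with * obtain K e where "compact K" "K \<subseteq> {0..}" "e > 0"
      "{v \<in> path_space. \<forall>t\<in>K. dist (v t) (w t) < e} \<subseteq> U"
      unfolding path_open_def by meson
    with U show "\<exists>K e. compact K \<and> K \<subseteq> {0..} \<and> e > 0 \<and>
        {v \<in> path_space. \<forall>t\<in>K. dist (v t) (w t) < e} \<subseteq> \<Union>\<K>"
      by (intro exI[of _ K] exI[of _ e]) auto
  qed
qed

lemma openin_path_topology: "openin path_topology U \<longleftrightarrow> path_open U"
  by (simp add: path_topology_def istopology_path_open topology_inverse')

lemma topspace_path_topology: "topspace path_topology = path_space"
proof -
  have "path_open path_space"
    unfolding path_open_def by (force intro: exI[of _ "{}"] exI[of _ "1::real"])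
  then show ?thesis
    unfolding topspace_def openin_path_topology by (auto simp: path_open_def)
qed

definition path_borel :: "(real \<Rightarrow> 'a::metric_space) measure" where
  "path_borel = sigma path_space {U. openin path_topology U}"

text \<open>Law on path space of standard Brownian motion started at \<open>x\<close>, as a predicate: these
  conditions fix all finite-dimensional distributions, hence \<open>M\<close> is unique. The density is that of
  \<open>N(0, (t - s) I)\<close>; the second argument of \<open>normal_density\<close> is the standard deviation.\<close>

definition brownian_law :: "real ^ 'n \<Rightarrow> (real \<Rightarrow> real ^ 'n) measure \<Rightarrow> bool" where
  "brownian_law x M \<longleftrightarrow>
     prob_space M \<and> sets M = sets path_borel \<and>
     (AE w in M. w 0 = x) \<and>
     (\<forall>(n::nat) (t::nat \<Rightarrow> real). 0 \<le> t 0 \<and> strict_mono_on {..n} t \<longrightarrow>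
        prob_space.indep_vars M (\<lambda>_. borel) (\<lambda>i w. w (t (Suc i)) - w (t i)) {..<n}) \<and>
     (\<forall>s t. 0 \<le> s \<and> s < t \<longrightarrow>
        distributed M lborel (\<lambda>w. w t - w s)
          (\<lambda>z. ennreal (\<Prod>i\<in>UNIV. normal_density 0 (sqrt (t - s)) (z $ i))))"

text \<open>The infimum is taken in \<^typ>\<open>ereal\<close>, so a path that never leaves \<open>U\<close> has exit time \<open>\<infinity>\<close>.\<close>

definition exit_time :: "'a set \<Rightarrow> (real \<Rightarrow> 'a) \<Rightarrow> ereal" where
  "exit_time U w = Inf (ereal ` {t. t > 0 \<and> w t \<notin> U})"

definition cond_law ::
    "('a \<Rightarrow> (real \<Rightarrow> 'a) measure) \<Rightarrow> 'a set \<Rightarrow> 'a \<Rightarrow> (real \<Rightarrow> 'a) set \<Rightarrow> real" where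
  "cond_law W U x A = cond_prob (W x) (\<lambda>w. w \<in> A) (\<lambda>w. exit_time U w > 1)"

end

theory Submission
  imports Defs
begin

text \<open>Outside \<open>B\<close> one has \<open>2 x\<^sub>1 \<le> |x|\<^sup>2\<close>. A path that leaves \<open>B\<close> at a time \<open>\<sigma> \<le> s\<close> survives in \<open>D\<close> up to
  time 1 with conditional probability at most a constant times the first coordinate of \<open>X\<^sub>\<sigma>\<close>, hence at
  most a constant times \<open>|X\<^sub>\<sigma>|\<^sup>2\<close>. As \<open>|X\<^sub>t|\<^sup>2 - d t\<close> is a martingale, the probability of leaving \<open>B\<close>
  before \<open>s\<close> and staying in \<open>D\<close> up to time 1 is bounded by a constant times
  \<open>\<lambda>\<^sup>2 + d E[\<tau>\<^sub>D \<and> s] = O(\<lambda>\<^sup>2 + \<lambda> \<surd>s)\<close>, because \<open>P(\<tau>\<^sub>D > t) \<le> \<lambda> / \<surd>t\<close>; and \<open>P(\<tau>\<^sub>D > 1) \<ge> \<lambda> / 8\<close>.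
  To avoid stopping times in continuous time, these estimates are made for the Gaussian random walk
  obtained by sampling the path at dyadic times, by exhibiting explicit supersolutions of the
  one-step recursion, and the mesh then tends to 0.\<close>

section \<open>Centred Gaussian measures\<close>

text \<open>Variance 0 has to be the point mass at 0, which the density formula does not give: the
  time left to a walk is 0 after its last step.\<close>

definition gauss :: "real \<Rightarrow> real measure" where
  "gauss v = (if v = 0 then return borel 0 else density lborel (normal_density 0 (sqrt v)))"

lemma sets_gauss [simp, measurable_cong]: "sets (gauss v) = sets borel"
  by (simp add: gauss_def)

lemma space_gauss [simp]: "space (gauss v) = UNIV"
  by (simp add: gauss_def)

lemma prob_space_gauss: "v \<ge> 0 \<Longrightarrow> prob_space (gauss v)"
  by (auto simp: gauss_def intro!: prob_space_normal_density prob_space_return)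

lemma convolution_gauss:
  assumes "v \<ge> 0" "h > 0"
  shows "gauss h \<star> gauss v = gauss (h + v)"
proof (cases "v = 0")
  case True
  interpret H: prob_space "gauss h" using assms by (intro prob_space_gauss) auto
  show ?thesis
  proof (rule measure_eqI)
    fix A assume "A \<in> sets (gauss h \<star> gauss v)"
    then have [measurable]: "A \<in> sets borel" by simp
    have "emeasure (gauss h \<star> gauss v) A = (\<integral>\<^sup>+x. \<integral>\<^sup>+y. indicator A (x + y) \<partial>gauss v \<partial>gauss h)"
      using assms by (intro convolution_emeasure') (auto simp: prob_space_gauss prob_space.finite_measure)
    also have "\<dots> = (\<integral>\<^sup>+x. indicator A x \<partial>gauss h)"
      by (intro nn_integral_cong) (simp add: True gauss_def nn_integral_return)
    finally show "emeasure (gauss h \<star> gauss v) A = emeasure (gauss (h + v)) A"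
      using True by simp
  qed simp
next
  case False
  with assms have v: "v > 0" by simp
  have "finite_measure (density lborel (normal_density 0 (sqrt u)))" if "u > 0" for u
    using that by (intro prob_space.finite_measure prob_space_normal_density) simp
  then have "gauss h \<star> gauss v = density lborel (\<lambda>x. \<integral>\<^sup>+y. ennreal (normal_density 0 (sqrt h) (x - y)) * ennreal (normal_density 0 (sqrt v) y) \<partial>lborel)"
    using v assms unfolding gauss_def by (subst convolution_density[symmetric]) auto
  also have "\<dots> = density lborel (normal_density 0 (sqrt ((sqrt h)\<^sup>2 + (sqrt v)\<^sup>2)))"
    using v assms by (subst conv_normal_density_zero_mean[symmetric]) (auto simp: ennreal_mult')
  also have "\<dots> = gauss (h + v)"
    using v assms by (simp add: gauss_def)
  finally show ?thesis .
qed

lemma emeasure_gauss_reflect: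
  assumes [measurable]: "A \<in> sets borel"
  shows "emeasure (gauss v) (uminus -` A) = emeasure (gauss v) A"
proof (cases "v = 0")
  case False
  have "emeasure (gauss v) (uminus -` A) = (\<integral>\<^sup>+x. ennreal (normal_density 0 (sqrt v) x) * indicator A (- x) \<partial>lborel)"
    using False measurable_sets_borel[OF borel_measurable_uminus[OF measurable_ident] assms]
    by (auto simp: gauss_def emeasure_density indicator_def intro!: nn_integral_cong)
  also have "\<dots> = (\<integral>\<^sup>+x. ennreal (normal_density 0 (sqrt v) x) * indicator A x \<partial>lborel)"
    by (subst nn_integral_real_affine[where c="-1" and t=0]) (auto simp: normal_density_def)
  finally show ?thesis
    using False by (simp add: gauss_def emeasure_density)
qed (use measurable_sets_borel[OF borel_measurable_uminus[OF measurable_ident] assms] in \<open>simp add: gauss_def indicator_def\<close>)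

text \<open>This is the expectation of \<open>sgn (y + Z)\<close> for \<open>Z\<close> centred Gaussian with variance \<open>v\<close> (up to the
  value at \<open>0\<close>), i.e. the odd solution of the heat equation; for \<open>y > 0\<close> it is the probability that
  Brownian motion started at \<open>y\<close> stays positive up to time \<open>v\<close>.\<close>

definition survival :: "real \<Rightarrow> real \<Rightarrow> real" where
  "survival v y = 2 * measure (gauss v) {- y<..} - 1"

lemma survival_mono: "v \<ge> 0 \<Longrightarrow> mono (survival v)"
  unfolding mono_def survival_def
  by (auto intro!: finite_measure.finite_measure_mono prob_space.finite_measure prob_space_gauss)

lemma borel_measurable_survival [measurable]: "v \<ge> 0 \<Longrightarrow> survival v \<in> borel_measurable borel"
  by (intro borel_measurable_mono survival_mono)

lemma abs_survival_le_1: "v \<ge> 0 \<Longrightarrow> \<bar>survival v y\<bar> \<le> 1"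
  using prob_space.prob_le_1[OF prob_space_gauss, of v "{-y<..}"] measure_nonneg[of "gauss v" "{-y<..}"]
  unfolding survival_def abs_le_iff by auto

lemma survival_0: "y > 0 \<Longrightarrow> survival 0 y = 1"
  by (simp add: survival_def gauss_def measure_return)

text \<open>By symmetry the two half-lines outside \<open>(-y, y)\<close> have equal mass, so twice
  the mass of \<open>{-y<..}\<close> minus 1 leaves the mass of the interval. The numerical bounds
  on \<open>survival\<close> are read off from this form of the reflection principle.\<close>

lemma survival_eq_measure:
  assumes "v \<ge> 0" "y > 0"
  shows "survival v y = measure (gauss v) {- y<..<y}"
proof -
  interpret prob_space "gauss v" using assms by (intro prob_space_gauss)
  have "uminus -` {..-y} = {y..}" by auto
  then have "prob {y..} = prob {..-y}"
    using emeasure_gauss_reflect[of "{..-y}" v] by (simp add: measure_def)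
  moreover have "prob {..-y} = 1 - prob {-y<..}"
    by (subst prob_compl[symmetric]) (auto intro!: arg_cong[where f="measure (gauss v)"])
  moreover have "prob {-y<..} = prob {-y<..<y} + prob {y..}"
    using assms by (subst finite_measure_Union[symmetric]) (auto intro!: arg_cong[where f="measure (gauss v)"])
  ultimately show ?thesis by (simp add: survival_def)
qed

lemma survival_nonneg: "v \<ge> 0 \<Longrightarrow> y > 0 \<Longrightarrow> survival v y \<ge> 0"
  by (simp add: survival_eq_measure)

text \<open>The half-lines \<open>{-y<..}\<close> and \<open>{..<y}\<close> are mirror images of
  each other and disjoint for \<open>y \<le> 0\<close>, so each has mass at most 1/2.\<close>

lemma survival_nonpos:
  assumes "v \<ge> 0" "y \<le> 0"
  shows "survival v y \<le> 0"
proof -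
  interpret prob_space "gauss v" using assms by (intro prob_space_gauss)
  have "uminus -` {-y<..} = {..<y}" by auto
  then have "prob {-y<..} = prob {..<y}"
    using emeasure_gauss_reflect[of "{-y<..}" v] by (simp add: measure_def)
  moreover have "prob ({-y<..} \<union> {..<y}) = prob {-y<..} + prob {..<y}"
    using assms by (intro finite_measure_Union) auto
  moreover have "prob ({-y<..} \<union> {..<y}) \<le> 1" by simp
  ultimately show ?thesis by (simp add: survival_def)
qed

text \<open>The density is at most \<open>1 / sqrt (2 * pi * v)\<close>, hence at most
  \<open>1 / (2 * sqrt v)\<close>, and the interval has length \<open>2 * y\<close>.\<close>

lemma survival_le:
  assumes "v > 0" "y \<ge> 0"
  shows "survival v y \<le> y / sqrt v"
proof (cases "y = 0")
  case False
  with assms have y: "y > 0" by simp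
  interpret prob_space "gauss v" using assms by (intro prob_space_gauss) auto
  have "ennreal (prob {-y<..<y}) = (\<integral>\<^sup>+x. ennreal (normal_density 0 (sqrt v) x) * indicator {-y<..<y} x \<partial>lborel)"
    using assms unfolding emeasure_eq_measure[symmetric] by (simp add: gauss_def emeasure_density)
  also have "\<dots> \<le> (\<integral>\<^sup>+x. ennreal (1 / (2 * sqrt v)) * indicator {-y<..<y} x \<partial>lborel)"
  proof (intro nn_integral_mono mult_right_mono ennreal_leI)
    fix x
    have "normal_density 0 (sqrt v) x \<le> 1 / sqrt (2 * pi * v) * 1"
      unfolding normal_density_def using assms by (intro mult_mono) auto
    also have "\<dots> \<le> 1 / sqrt (4 * v)"
      using assms pi_gt3 by (auto intro!: divide_left_mono)
    finally show "normal_density 0 (sqrt v) x \<le> 1 / (2 * sqrt v)"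
      by (simp add: real_sqrt_mult)
  qed simp
  also have "\<dots> = ennreal (1 / (2 * sqrt v) * (2 * y))"
    using assms y by (subst nn_integral_cmult_indicator) (auto simp: ennreal_mult'[symmetric])
  finally show ?thesis
    using assms y by (simp add: survival_eq_measure ennreal_le_iff)
qed (use assms survival_nonpos[of v 0] in auto)

lemma survival_1_ge:
  assumes "0 < y" "y \<le> 1"
  shows "survival 1 y \<ge> y / 4"
proof -
  interpret prob_space "gauss 1" by (intro prob_space_gauss) auto
  have "ennreal (y / 4) = ennreal (1 / 8 * (2 * y))"
    by simp
  also have "\<dots> = (\<integral>\<^sup>+x. ennreal (1 / 8) * indicator {-y<..<y} x \<partial>lborel)"
    using assms by (subst nn_integral_cmult_indicator) (auto simp: ennreal_mult'[symmetric])
  also have "\<dots> \<le> (\<integral>\<^sup>+x. ennreal (normal_density 0 1 x) * indicator {-y<..<y} x \<partial>lborel)"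
  proof (intro nn_integral_mono)
    fix x
    \<comment> \<open>On \<open>[-1, 1]\<close> the exponential is at least 1/2 and the normalising
      factor at least 1/4.\<close>
    have "1/8 \<le> normal_density 0 1 x" if "x \<in> {-y<..<y}"
    proof -
      have "x\<^sup>2 \<le> 1" using that assms by (auto simp: abs_square_le_1 abs_le_iff)
      then have "1/2 \<le> 1 + (- x\<^sup>2 / 2)" by simp
      also have "\<dots> \<le> exp (- x\<^sup>2 / 2)" by (rule exp_ge_add_one_self)
      finally have e: "1/2 \<le> exp (- x\<^sup>2 / 2)" .
      have "sqrt (2 * pi) \<le> sqrt (4\<^sup>2)" using pi_less_4 by (intro real_sqrt_le_mono) (auto simp: power2_eq_square)
      then have "1/4 \<le> 1 / sqrt (2 * pi)" using pi_gt_zero by (simp add: field_simps)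
      then have "1/4 * (1/2) \<le> 1 / sqrt (2 * pi) * exp (- x\<^sup>2 / 2)"
        using e by (intro mult_mono) auto
      then show ?thesis by (simp add: normal_density_def)
    qed
    then show "ennreal (1 / 8) * indicator {-y<..<y} x \<le> ennreal (normal_density 0 1 x) * indicator {-y<..<y} x"
      by (auto simp: indicator_def intro: ennreal_leI)
  qed
  also have "\<dots> = ennreal (prob {-y<..<y})"
    unfolding emeasure_eq_measure[symmetric] by (simp add: gauss_def emeasure_density)
  finally show ?thesis
    using assms by (simp add: survival_eq_measure ennreal_le_iff)
qed

lemma integrable_survival:
  "v \<ge> 0 \<Longrightarrow> h \<ge> 0 \<Longrightarrow> integrable (gauss h) (\<lambda>u. survival v (y + u))"
  by (rule finite_measure.integrable_const_bound[where B=1])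
     (auto simp: abs_survival_le_1 prob_space_gauss prob_space.finite_measure)

text \<open>The semigroup property of the heat flow, obtained from \<open>convolution_gauss\<close>.
  It makes \<open>survival\<close> of the remaining time an exact martingale along the walk without
  killing.\<close>

lemma integral_survival:
  assumes "v \<ge> 0" "h > 0"
  shows "(\<integral>u. survival v (y + u) \<partial>gauss h) = survival (h + v) y"
proof -
  interpret H: prob_space "gauss h" using assms by (intro prob_space_gauss) auto
  interpret V: prob_space "gauss v" using assms by (intro prob_space_gauss) auto
  interpret HV: prob_space "gauss (h + v)" using assms by (intro prob_space_gauss) auto
  \<comment> \<open>\<open>(survival v z + 1) / 2\<close> is the mass of \<open>{- z<..}\<close>; it
    is nonnegative, so the convolution formula for nonnegative integrals applies to it.\<close>
  have int: "integrable (gauss h) (\<lambda>u. (survival v (y + u) + 1) / 2)"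
    using integrable_survival[of v h y] assms by auto
  have nonneg: "0 \<le> (survival v z + 1) / 2" for z
    using abs_survival_le_1[OF \<open>v \<ge> 0\<close>, of z] by simp
  have "ennreal (HV.prob {-y<..}) = (\<integral>\<^sup>+u. emeasure (gauss v) {a. a + u \<in> {-y<..}} \<partial>gauss h)"
    unfolding HV.emeasure_eq_measure[symmetric] unfolding convolution_gauss[OF assms, symmetric]
    by (intro convolution_emeasure) (auto simp: H.finite_measure V.finite_measure)
  also have "\<dots> = (\<integral>\<^sup>+u. ennreal ((survival v (y + u) + 1) / 2) \<partial>gauss h)"
  proof (intro nn_integral_cong)
    fix u
    have "{a. a + u \<in> {-y<..}} = {- (y + u)<..}" by auto
    then show "emeasure (gauss v) {a. a + u \<in> {-y<..}} = ennreal ((survival v (y + u) + 1) / 2)"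
      by (simp add: survival_def V.emeasure_eq_measure)
  qed
  also have "\<dots> = ennreal (\<integral>u. (survival v (y + u) + 1) / 2 \<partial>gauss h)"
    using int nonneg by (intro nn_integral_eq_integral) auto
  finally have "HV.prob {-y<..} = (\<integral>u. (survival v (y + u) + 1) / 2 \<partial>gauss h)"
    using nonneg by (subst (asm) ennreal_inj) (auto intro!: integral_nonneg_AE simp del: divide_nonneg_pos)
  also have "\<dots> = ((\<integral>u. survival v (y + u) \<partial>gauss h) + 1) / 2"
    using integrable_survival[of v h y] assms by (simp add: H.prob_space[simplified])
  finally show ?thesis by (simp add: survival_def)
qed

section \<open>Second moment and tail of a real Gaussian\<close>

lemma nn_integral_gauss_square:
  assumes "h > 0"
  shows "(\<integral>\<^sup>+u. ennreal ((x + u)\<^sup>2) \<partial>gauss h) = ennreal (x\<^sup>2 + h)"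
proof -
  let ?f = "normal_density 0 (sqrt h)"
  have 1: "has_bochner_integral lborel (\<lambda>u. ?f u * u\<^sup>2) h"
    using normal_moment_even[of "sqrt h" 0 1] assms by simp
  have 2: "has_bochner_integral lborel (\<lambda>u. ?f u * u) 0"
    using normal_moment_nz_1[of "sqrt h" 0] assms by simp
  have 3: "has_bochner_integral lborel ?f 1"
    using assms by (simp add: has_bochner_integral_iff)
  have "has_bochner_integral lborel (\<lambda>u. x\<^sup>2 * ?f u + (2 * x) * (?f u * u) + ?f u * u\<^sup>2) (x\<^sup>2 * 1 + (2 * x) * 0 + h)"
    by (intro has_bochner_integral_add has_bochner_integral_mult_right 1 2 3)
  moreover have "(\<lambda>u. x\<^sup>2 * ?f u + (2 * x) * (?f u * u) + ?f u * u\<^sup>2) = (\<lambda>u. ?f u * (x + u)\<^sup>2)"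
    by (auto simp: power2_eq_square algebra_simps)
  ultimately have "has_bochner_integral lborel (\<lambda>u. ?f u * (x + u)\<^sup>2) (x\<^sup>2 + h)" by simp
  then have "(\<integral>\<^sup>+u. ennreal (?f u * (x + u)\<^sup>2) \<partial>lborel) = ennreal (x\<^sup>2 + h)"
    using assms by (subst nn_integral_eq_integral) (auto simp: has_bochner_integral_iff)
  then show ?thesis
    using assms by (simp add: gauss_def nn_integral_density ennreal_mult')
qed

text \<open>Markov's inequality with the fourth moment. The second moment would give
  \<open>h / \<delta> ^ 2\<close>, which summed over \<open>1 / h\<close> steps does not vanish as
  \<open>h\<close> tends to 0; the fourth leaves a total of order \<open>h\<close>.\<close>

lemma gauss_tail_le:
  assumes "h > 0" "\<delta> > 0"
  shows "measure (gauss h) {..- \<delta>} \<le> 3 * h\<^sup>2 / \<delta> ^ 4"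
proof -
  let ?f = "normal_density 0 (sqrt h)"
  interpret H: prob_space "gauss h" using assms by (intro prob_space_gauss) auto
  have 1: "has_bochner_integral lborel (\<lambda>u. ?f u * u ^ 4) (3 * h\<^sup>2)"
    using normal_moment_even[of "sqrt h" 0 2] assms by (simp add: fact_numeral power2_eq_square)
  have "has_bochner_integral lborel (\<lambda>u. ?f u * u ^ 4 * (1 / \<delta> ^ 4)) (3 * h\<^sup>2 * (1 / \<delta> ^ 4))"
    by (intro has_bochner_integral_mult_left 1)
  then have 2: "(\<integral>\<^sup>+u. ennreal (?f u * u ^ 4 * (1 / \<delta> ^ 4)) \<partial>lborel) = ennreal (3 * h\<^sup>2 * (1 / \<delta> ^ 4))"
    using assms by (subst nn_integral_eq_integral) (auto simp: has_bochner_integral_iff)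
  have "ennreal (H.prob {..-\<delta>}) = (\<integral>\<^sup>+u. ennreal (?f u) * indicator {..-\<delta>} u \<partial>lborel)"
    using assms unfolding H.emeasure_eq_measure[symmetric] by (simp add: gauss_def emeasure_density)
  also have "\<dots> \<le> (\<integral>\<^sup>+u. ennreal (?f u * u ^ 4 * (1 / \<delta> ^ 4)) \<partial>lborel)"
  proof (intro nn_integral_mono)
    fix u
    have "1 \<le> u ^ 4 / \<delta> ^ 4" if "u \<le> - \<delta>"
      using power_mono[of \<delta> "-u" 4] that assms by (simp add: field_simps)
    from mult_left_mono[OF this, of "?f u"]
    show "ennreal (?f u) * indicator {..-\<delta>} u \<le> ennreal (?f u * u ^ 4 * (1 / \<delta> ^ 4))"
      by (auto simp: indicator_def intro!: ennreal_leI)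
  qed
  finally show ?thesis
    unfolding 2 using assms by (subst (asm) ennreal_le_iff) auto
qed

section \<open>Gaussian vectors with independent coordinates\<close>

definition gauss_vec :: "real \<Rightarrow> (real ^ 'n) measure" where
  "gauss_vec h = density lborel (\<lambda>z. ennreal (\<Prod>i\<in>UNIV. normal_density 0 (sqrt h) (z $ i)))"

lemma sets_gauss_vec [simp, measurable_cong]: "sets (gauss_vec h) = sets borel"
  by (simp add: gauss_vec_def)

lemma space_gauss_vec [simp]: "space (gauss_vec h) = UNIV"
  by (simp add: gauss_vec_def)

lemma nn_integral_gauss_vec_component:
  fixes k :: "'n::finite"
  assumes h: "h > 0" and [measurable]: "g \<in> borel_measurable borel"
  shows "(\<integral>\<^sup>+z. g (z $ k) \<partial>gauss_vec h) = (\<integral>\<^sup>+u. g u \<partial>gauss h)"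
proof -
  let ?n = "normal_density 0 (sqrt h)"
  \<comment> \<open>One factor per basis vector, with \<open>g\<close> attached to the factor of
    coordinate \<open>k\<close>. The integral over the product splits, and all other factors
    integrate to 1.\<close>
  define f :: "real ^ 'n \<Rightarrow> real \<Rightarrow> ennreal" where
    "f b u = ennreal (?n u) * (if b = axis k 1 then g u else 1)" for b u
  have [measurable]: "f b \<in> borel_measurable borel" for b
    unfolding f_def by measurable
  have Basis: "(Basis :: (real ^ 'n) set) = range (\<lambda>i. axis i 1)"
    by (auto simp: Basis_vec_def)
  have inj: "inj (\<lambda>i::'n. axis i (1::real))"
    by (auto simp: inj_on_def axis_eq_axis)
  have one: "(\<integral>\<^sup>+u. ennreal (?n u) \<partial>lborel) = 1"
    using h by (subst nn_integral_eq_integral) auto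
  have "(\<integral>\<^sup>+z. g (z $ k) \<partial>gauss_vec h) = (\<integral>\<^sup>+z. ennreal (\<Prod>i\<in>UNIV. ?n (z $ i)) * g (z $ k) \<partial>lborel)"
    unfolding gauss_vec_def by (subst nn_integral_density) auto
  also have "\<dots> = (\<integral>\<^sup>+z. (\<Prod>b\<in>Basis. f b (z \<bullet> b)) \<partial>lborel)"
    unfolding Basis prod.reindex[OF inj]
    by (intro nn_integral_cong) (simp add: f_def inner_axis axis_eq_axis prod.distrib prod_ennreal prod.delta)
  also have "\<dots> = (\<Prod>b\<in>Basis. \<integral>\<^sup>+u. f b u \<partial>lborel)"
    by (intro nn_integral_lborel_prod) auto
  also have "\<dots> = (\<Prod>i\<in>UNIV. if i = k then \<integral>\<^sup>+u. g u \<partial>gauss h else 1)"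
    unfolding Basis prod.reindex[OF inj] using h one
    by (intro prod.cong) (auto simp: f_def[abs_def] axis_eq_axis gauss_def nn_integral_density)
  finally show ?thesis by simp
qed

lemma prob_space_gauss_vec:
  assumes "h > 0"
  shows "prob_space (gauss_vec h :: (real ^ 'n) measure)"
proof
  show "emeasure (gauss_vec h :: (real ^ 'n) measure) (space (gauss_vec h)) = 1"
    using nn_integral_gauss_vec_component[OF assms, of "\<lambda>_. 1" "undefined :: 'n"]
      prob_space.emeasure_space_1[OF prob_space_gauss, of h] assms by simp
qed

lemma nn_integral_gauss_vec_norm_square:
  fixes x :: "real ^ 'n" and h :: real
  assumes "h > 0"
  shows "(\<integral>\<^sup>+z. ennreal ((norm (x + z))\<^sup>2) \<partial>gauss_vec h) = ennreal ((norm x)\<^sup>2 + CARD('n) * h)"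
proof -
  have norm: "(norm y)\<^sup>2 = (\<Sum>i\<in>UNIV. (y $ i)\<^sup>2)" for y :: "real ^ 'n"
    unfolding power2_norm_eq_inner inner_vec_def by (simp add: power2_eq_square)
  have "(\<integral>\<^sup>+z. ennreal ((norm (x + z))\<^sup>2) \<partial>gauss_vec h)
      = (\<Sum>i\<in>UNIV. \<integral>\<^sup>+z. ennreal ((x $ i + z $ i)\<^sup>2) \<partial>gauss_vec h)"
    unfolding norm by (subst nn_integral_sum[symmetric]) (auto simp: sum_ennreal)
  also have "\<dots> = (\<Sum>i\<in>UNIV. ennreal ((x $ i)\<^sup>2 + h))"
    using assms
    by (intro sum.cong refl, subst nn_integral_gauss_vec_component) (auto simp: nn_integral_gauss_square)
  also have "\<dots> = ennreal ((norm x)\<^sup>2 + CARD('n) * h)"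
    using assms by (subst sum_ennreal) (auto simp: norm sum.distrib)
  finally show ?thesis .
qed

section \<open>Supermartingales driven by independent noise\<close>

text \<open>Induction on time: by Fubini the newest noise coordinate is integrated out first, and
  \<open>super\<close> replaces \<open>\<phi> (Suc i)\<close> by \<open>\<phi> i\<close>. A finite
  product measure takes the place of a filtration.\<close>

lemma nn_integral_PiM_supermartingale:
  fixes \<mu> :: "'a measure" and T :: "'s measure"
  assumes "prob_space \<mu>"
    and st0: "\<And>\<omega>. st 0 \<omega> = s0" and stS: "\<And>i \<omega>. st (Suc i) \<omega> = step i (st i \<omega>) (\<omega> i)"
    and s0: "s0 \<in> space T"
    and step: "\<And>i. (\<lambda>(s, z). step i s z) \<in> T \<Otimes>\<^sub>M \<mu> \<rightarrow>\<^sub>M T"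
    and \<phi>: "\<And>i. \<phi> i \<in> borel_measurable T"
    and super: "\<And>i s. i < n \<Longrightarrow> s \<in> space T \<Longrightarrow> (\<integral>\<^sup>+z. \<phi> (Suc i) (step i s z) \<partial>\<mu>) \<le> \<phi> i s"
  shows "st n \<in> Pi\<^sub>M {..<n} (\<lambda>_. \<mu>) \<rightarrow>\<^sub>M T \<and> (\<integral>\<^sup>+\<omega>. \<phi> n (st n \<omega>) \<partial>Pi\<^sub>M {..<n} (\<lambda>_. \<mu>)) \<le> \<phi> 0 s0"
proof -
  interpret prob_space \<mu> by fact
  interpret product_sigma_finite "\<lambda>_::nat. \<mu>" ..
  note [measurable] = step \<phi>
  \<comment> \<open>The state at time \<open>i\<close> reads only the coordinates below
    \<open>i\<close>, so overwriting coordinate \<open>i\<close> leaves it unchanged.\<close>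
  have cong: "st i \<omega> = st i \<omega>'" if "\<And>j. j < i \<Longrightarrow> \<omega> j = \<omega>' j" for i \<omega> \<omega>'
    using that by (induction i) (auto simp: st0 stS)
  have meas: "st i \<in> Pi\<^sub>M {..<j} (\<lambda>_. \<mu>) \<rightarrow>\<^sub>M T" if "i \<le> j" for i j
    using that
  proof (induction i)
    case 0
    then show ?case using s0 by (simp add: st0[abs_def])
  next
    case (Suc i)
    then have [measurable]: "st i \<in> Pi\<^sub>M {..<j} (\<lambda>_. \<mu>) \<rightarrow>\<^sub>M T" by simp
    have [measurable]: "(\<lambda>\<omega>. \<omega> i) \<in> Pi\<^sub>M {..<j} (\<lambda>_. \<mu>) \<rightarrow>\<^sub>M \<mu>"
      using Suc by (intro measurable_component_singleton) auto
    have "(\<lambda>\<omega>. (\<lambda>(s, z). step i s z) (st i \<omega>, \<omega> i)) \<in> Pi\<^sub>M {..<j} (\<lambda>_. \<mu>) \<rightarrow>\<^sub>M T"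
      by measurable
    then show ?case by (simp add: stS[abs_def])
  qed
  have "(\<integral>\<^sup>+\<omega>. \<phi> i (st i \<omega>) \<partial>Pi\<^sub>M {..<i} (\<lambda>_. \<mu>)) \<le> \<phi> 0 s0" if "i \<le> n" for i
    using that
  proof (induction i)
    case 0
    show ?case by (simp add: st0 PiM_empty nn_integral_count_space_finite)
  next
    case (Suc i)
    have [measurable]: "st (Suc i) \<in> Pi\<^sub>M (insert i {..<i}) (\<lambda>_. \<mu>) \<rightarrow>\<^sub>M T"
      using meas[of "Suc i" "Suc i"] by (simp add: lessThan_Suc)
    have "(\<integral>\<^sup>+\<omega>. \<phi> (Suc i) (st (Suc i) \<omega>) \<partial>Pi\<^sub>M {..<Suc i} (\<lambda>_. \<mu>))
        = (\<integral>\<^sup>+\<omega>. \<integral>\<^sup>+z. \<phi> (Suc i) (st (Suc i) (fun_upd \<omega> i z)) \<partial>\<mu> \<partial>Pi\<^sub>M {..<i} (\<lambda>_. \<mu>))"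
      unfolding lessThan_Suc by (subst product_nn_integral_insert) auto
    also have "\<dots> = (\<integral>\<^sup>+\<omega>. \<integral>\<^sup>+z. \<phi> (Suc i) (step i (st i \<omega>) z) \<partial>\<mu> \<partial>Pi\<^sub>M {..<i} (\<lambda>_. \<mu>))"
    proof (intro nn_integral_cong)
      fix \<omega> z
      have "st i (fun_upd \<omega> i z) = st i \<omega>" by (rule cong) auto
      then show "\<phi> (Suc i) (st (Suc i) (fun_upd \<omega> i z)) = \<phi> (Suc i) (step i (st i \<omega>) z)"
        by (simp add: stS)
    qed
    also have "\<dots> \<le> (\<integral>\<^sup>+\<omega>. \<phi> i (st i \<omega>) \<partial>Pi\<^sub>M {..<i} (\<lambda>_. \<mu>))"
      using Suc.prems measurable_space[OF meas[of i i]] by (intro nn_integral_mono super) auto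
    finally show ?case using Suc by simp
  qed
  then show ?thesis using meas by simp
qed

section \<open>Gaussian random walk in a half-space\<close>

text \<open>The shift by \<open>\<delta>\<close> absorbs the overshoot of a random walk below \<open>0\<close>; steps that overshoot by more
  than \<open>\<delta>\<close> are paid for by the second summand.\<close>

definition walk_survival :: "real \<Rightarrow> real \<Rightarrow> nat \<Rightarrow> real \<Rightarrow> real" where
  "walk_survival h \<delta> n x = survival (n * h) (x + \<delta>) + n * measure (gauss h) {..- \<delta>}"

lemma walk_survival_nonneg: "h > 0 \<Longrightarrow> \<delta> > 0 \<Longrightarrow> x > 0 \<Longrightarrow> walk_survival h \<delta> n x \<ge> 0"
  unfolding walk_survival_def by (intro add_nonneg_nonneg survival_nonneg) auto

lemma walk_survival_0: "\<delta> > 0 \<Longrightarrow> x > 0 \<Longrightarrow> walk_survival h \<delta> 0 x = 1"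
  by (simp add: walk_survival_def survival_0)

lemma borel_measurable_walk_survival [measurable]:
  "h > 0 \<Longrightarrow> walk_survival h \<delta> n \<in> borel_measurable borel"
  unfolding walk_survival_def[abs_def] by measurable

lemma walk_survival_le:
  assumes "h > 0" "\<delta> > 0" "x > 0" "n > 0"
  shows "walk_survival h \<delta> n x \<le> (x + \<delta>) / sqrt (n * h) + n * (3 * h\<^sup>2 / \<delta> ^ 4)"
  unfolding walk_survival_def using assms
  by (intro add_mono survival_le mult_left_mono gauss_tail_le) auto

text \<open>The killed integrand is dominated by \<open>?g\<close>, whose integral is exact:
  \<open>integral_survival\<close> advances the time by \<open>h\<close>, and the indicator
  contributes one more tail mass.\<close>

lemma nn_integral_walk_survival:
  assumes "h > 0" "\<delta> > 0" "x > 0"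
  shows "(\<integral>\<^sup>+u. (if x + u \<le> 0 then 0 else ennreal (walk_survival h \<delta> n (x + u))) \<partial>gauss h)
    \<le> ennreal (walk_survival h \<delta> (Suc n) x)"
proof -
  interpret prob_space "gauss h" using assms by (intro prob_space_gauss) auto
  define \<epsilon> where "\<epsilon> = prob {..-\<delta>}"
  have \<epsilon>: "\<epsilon> \<ge> 0" by (simp add: \<epsilon>_def)
  let ?g = "\<lambda>u. survival (n * h) ((x + \<delta>) + u) + indicator {..-\<delta>} u + n * \<epsilon>"
  have int: "integrable (gauss h) (\<lambda>u. survival (n * h) ((x + \<delta>) + u))"
    using assms by (intro integrable_survival) auto
  \<comment> \<open>If \<open>x + \<delta> + u \<le> 0\<close>, then
    \<open>u \<le> - \<delta>\<close> because \<open>x > 0\<close>, and the indicator 1 outweighs a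
    survival value of at least -1. Otherwise \<open>survival\<close> is itself nonnegative.\<close>
  have g0: "survival (n * h) ((x + \<delta>) + u) + indicator {..-\<delta>} u \<ge> 0" for u
    using assms survival_nonneg[of "n * h" "(x + \<delta>) + u"] abs_survival_le_1[of "n * h" "(x + \<delta>) + u"]
    by (cases "(x + \<delta>) + u > 0") (auto simp: indicator_def)
  have g: "?g u \<ge> 0" for u
    using \<epsilon> by (intro add_nonneg_nonneg[OF g0]) auto
  have ind: "integrable (gauss h) (indicator {..-\<delta>} :: real \<Rightarrow> real)"
    by (intro integrable_real_indicator) (auto simp: less_top[symmetric])
  have "(\<integral>\<^sup>+u. (if x + u \<le> 0 then 0 else ennreal (walk_survival h \<delta> n (x + u))) \<partial>gauss h)
      \<le> (\<integral>\<^sup>+u. ennreal (?g u) \<partial>gauss h)"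
    using \<epsilon> by (intro nn_integral_mono) (auto simp: walk_survival_def \<epsilon>_def algebra_simps intro!: ennreal_leI)
  also have "\<dots> = ennreal (\<integral>u. ?g u \<partial>gauss h)"
    using int ind g by (intro nn_integral_eq_integral) (auto intro!: Bochner_Integration.integrable_add)
  also have "(\<integral>u. ?g u \<partial>gauss h) = survival (h + n * h) (x + \<delta>) + \<epsilon> + n * \<epsilon>"
    using int ind assms prob_space by (simp add: integral_survival \<epsilon>_def)
  also have "\<dots> = walk_survival h \<delta> (Suc n) x"
    by (simp add: walk_survival_def \<epsilon>_def algebra_simps)
  finally show ?thesis .
qed

lemma measurable_vec_nth [measurable (raw)]:
  fixes f :: "'a \<Rightarrow> real ^ 'n"
  shows "f \<in> borel_measurable M \<Longrightarrow> (\<lambda>x. f x $ k) \<in> borel_measurable M"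
  using measurable_compose[OF _ borel_measurable_nth] .

text \<open>The walk is frozen once it leaves the half-space; the flag records whether it has met
  \<open>{x. x $ k < (norm x)\<^sup>2}\<close> at one of the times \<open>1, \<dots>, m\<close>.\<close>

definition chain_step ::
    "'n \<Rightarrow> nat \<Rightarrow> nat \<Rightarrow> (real ^ 'n) \<times> bool \<Rightarrow> real ^ 'n \<Rightarrow> (real ^ 'n) \<times> bool" where
  "chain_step k m i s z = (if fst s $ k \<le> 0 then s
     else (fst s + z, snd s \<or> Suc i \<le> m \<and> (fst s + z) $ k < (norm (fst s + z))\<^sup>2))"

primrec chain ::
    "'n \<Rightarrow> nat \<Rightarrow> real ^ 'n \<Rightarrow> nat \<Rightarrow> (nat \<Rightarrow> real ^ 'n) \<Rightarrow> (real ^ 'n) \<times> bool" where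
  "chain k m x 0 \<omega> = (x, False)"
| "chain k m x (Suc i) \<omega> = chain_step k m i (chain k m x i \<omega>) (\<omega> i)"

abbreviation chain_space :: "((real ^ 'n) \<times> bool) measure" where
  "chain_space \<equiv> borel \<Otimes>\<^sub>M count_space UNIV"

lemma measurable_chain_step:
  "(\<lambda>(s, z). chain_step k m i s z) \<in> chain_space \<Otimes>\<^sub>M gauss_vec h \<rightarrow>\<^sub>M chain_space"
  unfolding chain_step_def[abs_def] by measurable

lemma chain_supermartingale:
  fixes k :: "'n::finite"
  assumes "h > 0" and \<phi>: "\<And>i. \<phi> i \<in> borel_measurable chain_space"
    and super: "\<And>i s. i < n \<Longrightarrow> (\<integral>\<^sup>+z. \<phi> (Suc i) (chain_step k m i s z) \<partial>gauss_vec h) \<le> \<phi> i s"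
  shows "chain k m x n \<in> Pi\<^sub>M {..<n} (\<lambda>_. gauss_vec h) \<rightarrow>\<^sub>M chain_space"
    and "(\<integral>\<^sup>+\<omega>. \<phi> n (chain k m x n \<omega>) \<partial>Pi\<^sub>M {..<n} (\<lambda>_. gauss_vec h)) \<le> \<phi> 0 (x, False)"
  using nn_integral_PiM_supermartingale[of "gauss_vec h" "chain k m x" "(x, False)" "chain_step k m" chain_space \<phi> n]
    assms measurable_chain_step[of k m]
  by (auto simp: prob_space_gauss_vec space_pair_measure)

lemma measurable_chain:
  "h > 0 \<Longrightarrow> chain k m x n \<in> Pi\<^sub>M {..<n} (\<lambda>_. gauss_vec h) \<rightarrow>\<^sub>M chain_space"
  \<comment> \<open>The zero function is a supermartingale, which gives access to the measurability
    half.\<close>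
  using chain_supermartingale(1)[of h "\<lambda>_ _. 0"] by simp

lemma nn_integral_chain_alive_le:
  fixes k :: "'n::finite"
  assumes h: "h > 0" "\<delta> > 0" and x: "x $ k > 0"
  shows "(\<integral>\<^sup>+z. (if (x + z) $ k \<le> 0 then 0 else ennreal (walk_survival h \<delta> n ((x + z) $ k))) \<partial>gauss_vec h)
    \<le> ennreal (walk_survival h \<delta> (Suc n) (x $ k))"
  using nn_integral_walk_survival[OF h x, of n] h
    nn_integral_gauss_vec_component[of h "\<lambda>u. if x $ k + u \<le> 0 then 0 else ennreal (walk_survival h \<delta> n (x $ k + u))" k]
  unfolding vector_add_component by simp

text \<open>A walk watched only at grid times dies no more often than Brownian motion. The
  supermartingale is 1 after death and, before it, one minus the Brownian survival probability for
  the remaining time.\<close>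

lemma chain_dead_le:
  fixes k :: "'n::finite"
  assumes "h > 0" "x $ k > 0"
  shows "emeasure (Pi\<^sub>M {..<n} (\<lambda>_. gauss_vec h)) {\<omega> \<in> space (Pi\<^sub>M {..<n} (\<lambda>_. gauss_vec h)). fst (chain k m x n \<omega>) $ k \<le> 0}
     \<le> ennreal (1 - survival (n * h) (x $ k))"
proof -
  define \<phi> where "\<phi> i s = (if fst s $ k \<le> 0 then 1 else ennreal (1 - survival (real (n - i) * h) (fst s $ k)))"
    for i and s :: "(real ^ 'n) \<times> bool"
  have [measurable]: "\<phi> i \<in> borel_measurable chain_space" for i
    unfolding \<phi>_def[abs_def] using \<open>h > 0\<close> by (measurable, auto)
  have super: "(\<integral>\<^sup>+z. \<phi> (Suc i) (chain_step k m i s z) \<partial>gauss_vec h) \<le> \<phi> i s" if "i < n" for i s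
  proof (cases "fst s $ k \<le> 0")
    case True
    then show ?thesis
      using prob_space.emeasure_space_1[OF prob_space_gauss_vec[OF \<open>h > 0\<close>, where 'n='n]]
      by (simp add: \<phi>_def chain_step_def)
  next
    case False
    define v where "v = real (n - Suc i) * h"
    have *: "real (n - i) = 1 + real (n - Suc i)" using that by simp
    have v: "v \<ge> 0" "h + v = real (n - i) * h"
      using \<open>h > 0\<close> unfolding v_def * distrib_right by auto
    have "(\<integral>\<^sup>+z. \<phi> (Suc i) (chain_step k m i s z) \<partial>gauss_vec h)
        \<le> (\<integral>\<^sup>+z. ennreal (1 - survival v (fst s $ k + z $ k)) \<partial>gauss_vec h)"
    proof (intro nn_integral_mono)
      fix z
      \<comment> \<open>At an overshoot the heat solution is nonpositive, so its continuation below
        0 dominates the value 1 assigned to dead states.\<close>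
      have "1 \<le> ennreal (1 - survival v y)" if "y \<le> 0" for y
        using ennreal_leI[of 1 "1 - survival v y"] survival_nonpos[OF v(1) that] by simp
      then show "\<phi> (Suc i) (chain_step k m i s z) \<le> ennreal (1 - survival v (fst s $ k + z $ k))"
        using False by (simp add: \<phi>_def chain_step_def v_def)
    qed
    also have "\<dots> = (\<integral>\<^sup>+u. ennreal (1 - survival v (fst s $ k + u)) \<partial>gauss h)"
      using \<open>h > 0\<close> v by (intro nn_integral_gauss_vec_component) auto
    also have "\<dots> = ennreal (\<integral>u. 1 - survival v (fst s $ k + u) \<partial>gauss h)"
    proof (rule nn_integral_eq_integral)
      interpret prob_space "gauss h" using assms by (intro prob_space_gauss) auto
      show "integrable (gauss h) (\<lambda>u. 1 - survival v (fst s $ k + u))"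
        using v \<open>h > 0\<close> by (auto intro!: Bochner_Integration.integrable_diff integrable_survival)
      show "AE u in gauss h. 0 \<le> 1 - survival v (fst s $ k + u)"
        using abs_survival_le_1[OF v(1)] by (auto simp: abs_le_iff)
    qed
    also have "(\<integral>u. 1 - survival v (fst s $ k + u) \<partial>gauss h) = 1 - survival (h + v) (fst s $ k)"
    proof -
      interpret prob_space "gauss h" using assms by (intro prob_space_gauss) auto
      show ?thesis
        using v \<open>h > 0\<close> prob_space by (subst Bochner_Integration.integral_diff) (auto simp: integral_survival integrable_survival)
    qed
    finally show ?thesis using False by (simp add: \<phi>_def v)
  qed
  have [measurable]: "chain k m x n \<in> Pi\<^sub>M {..<n} (\<lambda>_. gauss_vec h) \<rightarrow>\<^sub>M chain_space"
    by (rule measurable_chain) fact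
  let ?P = "Pi\<^sub>M {..<n} (\<lambda>_. gauss_vec h :: (real ^ 'n) measure)"
  let ?A = "{\<omega> \<in> space ?P. fst (chain k m x n \<omega>) $ k \<le> 0}"
  have "emeasure ?P ?A = (\<integral>\<^sup>+\<omega>. indicator ?A \<omega> \<partial>?P)"
    by simp
  also have "\<dots> \<le> (\<integral>\<^sup>+\<omega>. \<phi> n (chain k m x n \<omega>) \<partial>?P)"
    by (intro nn_integral_mono) (auto simp: \<phi>_def indicator_def)
  also have "\<dots> \<le> \<phi> 0 (x, False)"
    by (rule chain_supermartingale(2)[OF \<open>h > 0\<close> _ super]) auto
  finally show ?thesis using \<open>x $ k > 0\<close> by (simp add: \<phi>_def)
qed

text \<open>Once flagged, the chain is charged \<open>q\<close>, a bound for surviving the remaining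
  steps. Before that it is charged \<open>V\<close>, which dominates the expectation of
  \<open>2 * (norm y)\<^sup>2 + c\<close> at the flagging time; as flagging happens where
  \<open>y $ k < (norm y)\<^sup>2\<close>, this covers \<open>q\<close>.\<close>

lemma chain_bad_le:
  fixes k :: "'n::finite" and h :: real
  assumes "n > 0" "2 * m \<le> n" "x $ k > 0" "\<delta> > 0" and h_def: "h = 1 / n"
    and c_def: "c = 2 * \<delta> + 3 * h / \<delta> ^ 4"
  shows "emeasure (Pi\<^sub>M {..<n} (\<lambda>_. gauss_vec h))
      {\<omega> \<in> space (Pi\<^sub>M {..<n} (\<lambda>_. gauss_vec h)). fst (chain k m x n \<omega>) $ k > 0 \<and> snd (chain k m x n \<omega>)}
     \<le> ennreal (2 * (norm x)\<^sup>2 + c + (\<Sum>l<m. 2 * CARD('n) * h * walk_survival h \<delta> l (x $ k)))"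
proof -
  have h: "h > 0" using assms by simp
  define K where "K = 2 * CARD('n) * h"
  have K: "K \<ge> 0" using h by (simp add: K_def)
  have c: "c \<ge> 0" using h \<open>\<delta> > 0\<close> by (simp add: c_def)
  define q where "q l y = (if y \<le> 0 then 0 else ennreal (walk_survival h \<delta> l y))" for l y
  \<comment> \<open>Each step raises the expectation of \<open>2 * (norm y)\<^sup>2\<close> by
    \<open>K\<close>, but only while the chain is alive. The sum prepays \<open>K\<close> times the
    bound \<open>q l\<close> for being alive \<open>l\<close> steps ahead, over the steps left
    before \<open>m\<close>.\<close>
  define V where "V i y = ennreal (2 * (norm y)\<^sup>2 + c) + (\<Sum>l<m-i. ennreal K * q l (y $ k))"
    for i and y :: "real ^ 'n"
  \<comment> \<open>An unflagged chain later than \<open>m\<close> can no longer be flagged, hence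
    the final 0.\<close>
  define \<phi> where "\<phi> i s = (if fst s $ k \<le> 0 then 0 else if snd s then q (n - i) (fst s $ k)
      else if i \<le> m then V i (fst s) else 0)" for i and s :: "(real ^ 'n) \<times> bool"
  have [measurable]: "q l \<in> borel_measurable borel" for l
    unfolding q_def[abs_def] using h by measurable
  have [measurable]: "V i \<in> borel_measurable borel" for i
    unfolding V_def[abs_def] by measurable
  have [measurable]: "\<phi> i \<in> borel_measurable chain_space" for i
    unfolding \<phi>_def[abs_def] by measurable
  have q_step: "(\<integral>\<^sup>+z. q l ((y + z) $ k) \<partial>gauss_vec h) \<le> q (Suc l) (y $ k)" if "y $ k > 0" for l y
    using nn_integral_chain_alive_le[OF h \<open>\<delta> > 0\<close> that, of l, unfolded vector_add_component] that by (simp add: q_def)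
  have q_le_V: "q (n - i) (y $ k) \<le> V i y" if "i \<le> m" "y $ k > 0" "y $ k < (norm y)\<^sup>2" for i y
  proof -
    \<comment> \<open>At least half of the unit time remains; the weaker \<open>n / 4\<close> is
      taken because \<open>1 / 4\<close> has the square root \<open>1 / 2\<close>. With
      \<open>n * h = 1\<close>, the constant \<open>c\<close> collects the \<delta>-shift and the
      tail term of \<open>walk_survival_le\<close>.\<close>
    have n2: "real n / 4 \<le> real (n - i)" and ni: "n - i > 0"
      using \<open>2 * m \<le> n\<close> that \<open>n > 0\<close> by auto
    have "walk_survival h \<delta> (n - i) (y $ k) \<le> (y $ k + \<delta>) / sqrt (real (n - i) * h) + real (n - i) * (3 * h\<^sup>2 / \<delta> ^ 4)"
      using that ni h \<open>\<delta> > 0\<close> by (intro walk_survival_le) auto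
    also have "\<dots> \<le> (y $ k + \<delta>) / (1 / 2) + real n * (3 * h\<^sup>2 / \<delta> ^ 4)"
    proof (intro add_mono divide_left_mono mult_right_mono)
      have "1 / 4 \<le> real (n - i) * h" using n2 \<open>n > 0\<close> by (simp add: h_def field_simps)
      then have "sqrt (1 / 4) \<le> sqrt (real (n - i) * h)" by (rule real_sqrt_le_mono)
      then show "1 / 2 \<le> sqrt (real (n - i) * h)" by (simp add: real_sqrt_divide)
    qed (use that \<open>\<delta> > 0\<close> h ni in auto)
    also have "\<dots> = 2 * (y $ k) + c"
      using \<open>n > 0\<close> by (simp add: c_def h_def field_simps power2_eq_square)
    also have "\<dots> \<le> 2 * (norm y)\<^sup>2 + c" using that by simp
    finally have "q (n - i) (y $ k) \<le> ennreal (2 * (norm y)\<^sup>2 + c)"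
      using that by (auto simp: q_def intro!: ennreal_leI)
    also have "\<dots> \<le> V i y" by (simp add: V_def)
    finally show ?thesis .
  qed
  have super: "(\<integral>\<^sup>+z. \<phi> (Suc i) (chain_step k m i s z) \<partial>gauss_vec h) \<le> \<phi> i s" if "i < n" for i s
  proof -
    obtain y b where s: "s = (y, b)" by (cases s)
    consider "y $ k \<le> 0" | "y $ k > 0" b | "y $ k > 0" "\<not> b" "\<not> Suc i \<le> m" | "y $ k > 0" "\<not> b" "Suc i \<le> m"
      by linarith
    then show ?thesis
    proof cases
      case 1
      then show ?thesis by (simp add: \<phi>_def chain_step_def s)
    next
      case 2
      have "(\<integral>\<^sup>+z. \<phi> (Suc i) (chain_step k m i s z) \<partial>gauss_vec h)
          \<le> (\<integral>\<^sup>+z. q (n - Suc i) ((y + z) $ k) \<partial>gauss_vec h)"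
        using 2 by (intro nn_integral_mono) (auto simp: \<phi>_def chain_step_def s)
      also have "\<dots> \<le> q (Suc (n - Suc i)) (y $ k)" using 2 by (intro q_step)
      finally show ?thesis using 2 that by (simp add: \<phi>_def s Suc_diff_Suc)
    next
      case 3
      have "(\<integral>\<^sup>+z. \<phi> (Suc i) (chain_step k m i s z) \<partial>gauss_vec h) = (\<integral>\<^sup>+z. 0 \<partial>(gauss_vec h :: (real ^ 'n) measure))"
        using 3 by (intro nn_integral_cong) (auto simp: \<phi>_def chain_step_def s)
      then show ?thesis by simp
    next
      case 4
      interpret G: prob_space "gauss_vec h :: (real ^ 'n) measure" by (rule prob_space_gauss_vec[OF h])
      have "(\<integral>\<^sup>+z. \<phi> (Suc i) (chain_step k m i s z) \<partial>gauss_vec h) \<le> (\<integral>\<^sup>+z. V (Suc i) (y + z) \<partial>gauss_vec h)"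
      proof (intro nn_integral_mono)
        show "\<phi> (Suc i) (chain_step k m i s z) \<le> V (Suc i) (y + z)" for z
          using 4 q_le_V[of "Suc i" "y + z"] by (auto simp: \<phi>_def chain_step_def s)
      qed
      also have "\<dots> = (\<integral>\<^sup>+z. 2 * ennreal ((norm (y + z))\<^sup>2) + ennreal c + (\<Sum>l<m-Suc i. ennreal K * q l ((y + z) $ k)) \<partial>gauss_vec h)"
        using c by (intro nn_integral_cong) (simp add: V_def ennreal_plus ennreal_mult')
      also have "\<dots> = 2 * ennreal ((norm y)\<^sup>2 + CARD('n) * h) + ennreal c + (\<Sum>l<m-Suc i. ennreal K * (\<integral>\<^sup>+z. q l ((y + z) $ k) \<partial>gauss_vec h))"
        unfolding nn_integral_gauss_vec_norm_square[OF h, symmetric] using G.emeasure_space_1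
        by (simp add: nn_integral_add nn_integral_sum nn_integral_cmult del: vector_add_component)
      also have "\<dots> \<le> 2 * ennreal ((norm y)\<^sup>2 + CARD('n) * h) + ennreal c + (\<Sum>l<m-Suc i. ennreal K * q (Suc l) (y $ k))"
        using 4 by (intro add_left_mono sum_mono mult_left_mono q_step) auto
      also have "2 * ennreal ((norm y)\<^sup>2 + CARD('n) * h) = ennreal (2 * (norm y)\<^sup>2 + K)"
        using h by (simp add: K_def algebra_simps flip: ennreal_numeral ennreal_mult')
      \<comment> \<open>A living state has \<open>q 0 = 1\<close>, so the increment \<open>K\<close>
        is exactly the missing term \<open>l = 0\<close> of the shifted sum.\<close>
      also have "\<dots> + ennreal c + (\<Sum>l<m-Suc i. ennreal K * q (Suc l) (y $ k))
          = ennreal (2 * (norm y)\<^sup>2 + c) + (ennreal K * q 0 (y $ k) + (\<Sum>l<m-Suc i. ennreal K * q (Suc l) (y $ k)))"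
        using 4 c K \<open>\<delta> > 0\<close> by (simp add: q_def walk_survival_0 ennreal_plus ac_simps)
      also have "ennreal K * q 0 (y $ k) + (\<Sum>l<m-Suc i. ennreal K * q (Suc l) (y $ k)) = (\<Sum>l<Suc (m - Suc i). ennreal K * q l (y $ k))"
        by (rule sum.lessThan_Suc_shift[symmetric])
      also have "Suc (m - Suc i) = m - i" using 4 by simp
      finally show ?thesis using 4 by (simp add: \<phi>_def s V_def)
    qed
  qed
  have [measurable]: "chain k m x n \<in> Pi\<^sub>M {..<n} (\<lambda>_. gauss_vec h) \<rightarrow>\<^sub>M chain_space"
    by (rule measurable_chain) fact
  let ?P = "Pi\<^sub>M {..<n} (\<lambda>_. gauss_vec h :: (real ^ 'n) measure)"
  let ?A = "{\<omega> \<in> space ?P. fst (chain k m x n \<omega>) $ k > 0 \<and> snd (chain k m x n \<omega>)}"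
  have "emeasure ?P ?A = (\<integral>\<^sup>+\<omega>. indicator ?A \<omega> \<partial>?P)"
    by simp
  also have "\<dots> \<le> (\<integral>\<^sup>+\<omega>. \<phi> n (chain k m x n \<omega>) \<partial>?P)"
    using \<open>\<delta> > 0\<close> by (intro nn_integral_mono) (auto simp: \<phi>_def q_def indicator_def walk_survival_0)
  also have "\<dots> \<le> \<phi> 0 (x, False)"
    by (rule chain_supermartingale(2)[OF \<open>h > 0\<close> _ super]) auto
  also have "\<dots> = ennreal (2 * (norm x)\<^sup>2 + c) + (\<Sum>l<m. ennreal (K * walk_survival h \<delta> l (x $ k)))"
    using \<open>x $ k > 0\<close> K by (simp add: \<phi>_def V_def q_def ennreal_mult')
  also have "\<dots> = ennreal (2 * (norm x)\<^sup>2 + c + (\<Sum>l<m. K * walk_survival h \<delta> l (x $ k)))"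
    using K c h \<open>\<delta> > 0\<close> \<open>x $ k > 0\<close>
    by (subst sum_ennreal) (auto simp: walk_survival_nonneg sum_nonneg ennreal_plus[symmetric] simp del: ennreal_plus)
  finally show ?thesis by (simp add: K_def)
qed

lemma sum_inverse_sqrt_le: "(\<Sum>l<m. 1 / sqrt (Suc l)) \<le> 2 * sqrt m"
proof (induction m)
  case (Suc m)
  \<comment> \<open>This is \<open>2 * sqrt (m + 1) * sqrt m \<le> 2 * m + 1\<close> rearranged; it
    bounds each summand by a telescoping difference.\<close>
  have "1 \<le> 2 * sqrt (Suc m) * (sqrt (Suc m) - sqrt m)"
    using sum_squares_bound[of "sqrt (Suc m)" "sqrt m"] by (simp add: algebra_simps)
  then have "1 / sqrt (Suc m) \<le> 2 * (sqrt (Suc m) - sqrt m)"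
    by (simp only: pos_divide_le_eq[of "sqrt (Suc m)"] real_sqrt_gt_0_iff of_nat_0_less_iff zero_less_Suc mult_ac)
  then show ?case using Suc by simp
qed simp

text \<open>A Riemann sum for the integral of \<open>(y + \<delta>) / sqrt t\<close> over
  \<open>[0, s]\<close>, bounding the expected time alive before \<open>s\<close>. The term
  \<open>l = 0\<close> gives the extra \<open>h\<close>; the tail corrections, at most
  \<open>3 * h / \<delta> ^ 4\<close> per step, are weighted by a total time of at most 1.\<close>

lemma sum_walk_survival_le:
  fixes h :: real and n m :: nat
  assumes "n > 0" "2 * m \<le> n" "y > 0" "\<delta> > 0" and h_def: "h = 1 / n" and s: "m * h \<le> s"
  shows "(\<Sum>l<m. h * walk_survival h \<delta> l y) \<le> h + 2 * (y + \<delta>) * sqrt s + 3 * h / \<delta> ^ 4"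
proof (cases m)
  case 0
  then show ?thesis using assms by auto
next
  case (Suc j)
  have h: "h > 0" using assms by simp
  have "(\<Sum>l<m. h * walk_survival h \<delta> l y) = h + (\<Sum>l<j. h * walk_survival h \<delta> (Suc l) y)"
    unfolding Suc sum.lessThan_Suc_shift using assms by (simp add: walk_survival_0)
  also have "(\<Sum>l<j. h * walk_survival h \<delta> (Suc l) y) \<le> (\<Sum>l<j. sqrt h * (y + \<delta>) * (1 / sqrt (Suc l)) + h * (3 * h / \<delta> ^ 4))"
  proof (intro sum_mono)
    fix l assume "l \<in> {..<j}"
    then have l: "Suc l \<le> n" using Suc assms by auto
    have "walk_survival h \<delta> (Suc l) y \<le> (y + \<delta>) / sqrt (Suc l * h) + Suc l * (3 * h\<^sup>2 / \<delta> ^ 4)"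
      using assms h by (intro walk_survival_le) auto
    also have "\<dots> \<le> (y + \<delta>) / sqrt (Suc l * h) + n * (3 * h\<^sup>2 / \<delta> ^ 4)"
      using l assms by (intro add_left_mono mult_right_mono) auto
    also have "n * (3 * h\<^sup>2 / \<delta> ^ 4) = 3 * h / \<delta> ^ 4"
      using assms by (simp add: power2_eq_square)
    finally have "h * walk_survival h \<delta> (Suc l) y \<le> h * ((y + \<delta>) / sqrt (Suc l * h) + 3 * h / \<delta> ^ 4)"
      using h by (intro mult_left_mono) auto
    also have "h * ((y + \<delta>) / sqrt (Suc l * h) + 3 * h / \<delta> ^ 4) = (h / sqrt h) * (y + \<delta>) * (1 / sqrt (Suc l)) + h * (3 * h / \<delta> ^ 4)"
      unfolding distrib_left[of h] real_sqrt_mult by (simp add: ac_simps)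
    also have "h / sqrt h = sqrt h" using h by (simp add: real_div_sqrt)
    finally show "h * walk_survival h \<delta> (Suc l) y \<le> sqrt h * (y + \<delta>) * (1 / sqrt (Suc l)) + h * (3 * h / \<delta> ^ 4)" .
  qed
  also have "\<dots> = sqrt h * (y + \<delta>) * (\<Sum>l<j. 1 / sqrt (Suc l)) + j * h * (3 * h / \<delta> ^ 4)"
    by (simp add: sum.distrib sum_distrib_left)
  also have "\<dots> \<le> sqrt h * (y + \<delta>) * (2 * sqrt m) + 1 * (3 * h / \<delta> ^ 4)"
  proof (intro add_mono mult_left_mono mult_right_mono)
    show "(\<Sum>l<j. 1 / sqrt (Suc l)) \<le> 2 * sqrt m"
      using sum_inverse_sqrt_le[of j] Suc by (smt (verit) real_sqrt_le_mono of_nat_Suc)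
    show "j * h \<le> 1" using Suc \<open>2 * m \<le> n\<close> \<open>n > 0\<close> by (simp add: h_def)
  qed (use assms h in auto)
  also have "sqrt h * (y + \<delta>) * (2 * sqrt m) = 2 * (y + \<delta>) * sqrt (m * h)"
    by (simp add: real_sqrt_mult)
  also have "\<dots> \<le> 2 * (y + \<delta>) * sqrt s"
    using s assms by (intro mult_left_mono) auto
  finally show ?thesis by simp
qed

section \<open>From the walk to Brownian paths\<close>

text \<open>A Fatou argument: up to a null set \<open>A\<close> lies in the increasing union of the
  \<open>L p\<close>, and \<open>L p\<close> is contained in every later \<open>E q\<close>.
  \<open>A\<close> is an arbitrary set, so exit events can be inserted directly.\<close>

lemma (in finite_measure) measure_le_of_AE_eventually:
  fixes b :: "nat \<Rightarrow> real"
  assumes A: "AE w in M. w \<in> A \<longrightarrow> (\<forall>\<^sub>F p in sequentially. w \<in> E p)"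
    and [measurable]: "\<And>p. E p \<in> sets M"
    and le: "\<And>p. measure M (E p) \<le> b p" and b: "b \<longlonglongrightarrow> c"
  shows "measure M A \<le> c"
proof -
  define L where "L p = (\<Inter>q\<in>{p..}. E q)" for p
  have [measurable]: "L p \<in> sets M" for p
    unfolding L_def by (intro sets.countable_INT') auto
  have "incseq L" by (auto simp: L_def incseq_def)
  have Lc: "measure M (L p) \<le> c" for p
  proof (rule tendsto_lowerbound[OF b])
    show "\<forall>\<^sub>F q in sequentially. measure M (L p) \<le> b q"
      using eventually_ge_at_top[of p]
    proof eventually_elim
      case (elim q)
      then have "measure M (L p) \<le> measure M (E q)"
        by (intro finite_measure_mono) (auto simp: L_def)
      with le[of q] show ?case by simp
    qed
  qed simp
  have "measure M A \<le> measure M (\<Union>p. L p)"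
    using A by (intro finite_measure_mono_AE) (auto simp: L_def eventually_sequentially elim!: eventually_mono)
  also have "\<dots> \<le> c"
    using finite_Lim_measure_incseq[OF _ \<open>incseq L\<close>, OF image_subsetI] Lc by (intro LIMSEQ_le_const2[of "\<lambda>p. measure M (L p)"]) auto
  finally show ?thesis .
qed

section \<open>The chain as a function of the sampled path\<close>

definition walk :: "real ^ 'n \<Rightarrow> nat \<Rightarrow> (nat \<Rightarrow> real ^ 'n) \<Rightarrow> real ^ 'n" where
  "walk x j \<omega> = x + (\<Sum>i<j. \<omega> i)"

text \<open>Freezing takes effect one step after the walk leaves, so positivity is asked only
  strictly before \<open>j\<close>. This admits the first exit index itself in
  \<open>chain_dead\<close>.\<close>

lemma chain_eq_walk:
  assumes "\<And>i. i < j \<Longrightarrow> walk x i \<omega> $ k > 0"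
  shows "chain k m x j \<omega> =
    (walk x j \<omega>, \<exists>i\<in>{1..j}. i \<le> m \<and> walk x i \<omega> $ k < (norm (walk x i \<omega>))\<^sup>2)"
  using assms
proof (induction j)
  case 0
  then show ?case by (simp add: walk_def)
next
  case (Suc j)
  have S: "walk x j \<omega> + \<omega> j = walk x (Suc j) \<omega>" by (simp add: walk_def)
  have "chain k m x j \<omega> = (walk x j \<omega>, \<exists>i\<in>{1..j}. i \<le> m \<and> walk x i \<omega> $ k < (norm (walk x i \<omega>))\<^sup>2)"
    using Suc by simp
  moreover have "{1..Suc j} = insert (Suc j) {1..j}" by auto
  moreover have "\<not> walk x j \<omega> $ k \<le> 0" using Suc.prems[of j] by simp
  ultimately show ?case
    by (auto simp: chain_step_def S)
qed

text \<open>Up to the first nonpositive index the chain follows the walk; from there on it is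
  frozen.\<close>

lemma chain_dead:
  assumes "j \<le> n" "walk x j \<omega> $ k \<le> 0"
  shows "fst (chain k m x n \<omega>) $ k \<le> 0"
proof -
  define i where "i = (LEAST i. walk x i \<omega> $ k \<le> 0)"
  have i: "walk x i \<omega> $ k \<le> 0" using assms(2) unfolding i_def by (rule LeastI[of "\<lambda>i. walk x i \<omega> $ k \<le> 0"])
  have "i \<le> j" using assms(2) unfolding i_def by (rule Least_le[of "\<lambda>i. walk x i \<omega> $ k \<le> 0"])
  have "walk x l \<omega> $ k > 0" if "l < i" for l
    using not_less_Least[of l "\<lambda>i. walk x i \<omega> $ k \<le> 0"] that by (simp add: i_def)
  then have "fst (chain k m x i \<omega>) $ k \<le> 0"
    using i by (subst chain_eq_walk) auto
  moreover have "i \<le> n" using \<open>i \<le> j\<close> assms by simp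
  ultimately show ?thesis
    by (induction rule: dec_induct[OF \<open>i \<le> n\<close>]) (auto simp: chain_step_def)
qed

lemma dyadic_floor_tendsto:
  assumes "t \<ge> 0"
  shows "(\<lambda>p. real (nat \<lfloor>t * 2 ^ p\<rfloor>) / 2 ^ p) \<longlonglongrightarrow> t"
proof (rule tendsto_sandwich)
  show "\<forall>\<^sub>F p in sequentially. t - (1 / 2) ^ p \<le> real (nat \<lfloor>t * 2 ^ p\<rfloor>) / 2 ^ p"
  proof (intro always_eventually allI)
    fix p :: nat
    have "t * 2 ^ p - 1 \<le> real (nat \<lfloor>t * 2 ^ p\<rfloor>)" using assms by linarith
    then have "(t * 2 ^ p - 1) / 2 ^ p \<le> real (nat \<lfloor>t * 2 ^ p\<rfloor>) / 2 ^ p"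
      by (intro divide_right_mono) auto
    then show "t - (1 / 2) ^ p \<le> real (nat \<lfloor>t * 2 ^ p\<rfloor>) / 2 ^ p"
      by (simp add: diff_divide_distrib power_one_over)
  qed
  show "\<forall>\<^sub>F p in sequentially. real (nat \<lfloor>t * 2 ^ p\<rfloor>) / 2 ^ p \<le> t"
    using assms by (intro always_eventually allI) (simp add: divide_le_eq of_nat_nat)
  have "(\<lambda>p. t - (1 / 2 :: real) ^ p) \<longlonglongrightarrow> t - 0"
    by (intro tendsto_diff tendsto_const LIMSEQ_realpow_zero) auto
  then show "(\<lambda>p. t - (1 / 2 :: real) ^ p) \<longlonglongrightarrow> t" by simp
qed simp

definition increments :: "nat \<Rightarrow> (real \<Rightarrow> real ^ 'n) \<Rightarrow> nat \<Rightarrow> real ^ 'n" where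
  "increments n w = (\<lambda>i\<in>{..<n}. w (real (Suc i) / n) - w (real i / n))"

text \<open>The start \<open>x\<close> is kept apart from \<open>w 0\<close>: the survival estimate
  runs the walk from a point nearer to the boundary than the path.\<close>

lemma walk_increments: "j \<le> n \<Longrightarrow> walk x j (increments n w) = x + (w (real j / n) - w 0)"
  using sum_lessThan_telescope[of "\<lambda>i. w (real i / n)" j]
  by (simp add: walk_def increments_def cong: sum.cong_simp)

text \<open>Independence makes the joint law the product of the marginals, and each marginal has the
  \<open>gauss_vec\<close> density for the time step \<open>1 / n\<close>.\<close>

lemma brownian_increments:
  fixes M :: "(real \<Rightarrow> real ^ 'n) measure"
  assumes W: "brownian_law x M" and n: "n > 0"
  shows measurable_increments: "increments n \<in> M \<rightarrow>\<^sub>M Pi\<^sub>M {..<n} (\<lambda>_. gauss_vec (1 / n))" (is ?meas)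
    and distr_increments: "distr M (Pi\<^sub>M {..<n} (\<lambda>_. gauss_vec (1 / n))) (increments n) = Pi\<^sub>M {..<n} (\<lambda>_. gauss_vec (1 / n))" (is ?distr)
proof -
  interpret prob_space M using W by (simp add: brownian_law_def)
  define X where "X i w = w (real (Suc i) / n) - w (real i / n)" for i :: nat and w :: "real \<Rightarrow> real ^ 'n"
  have "strict_mono_on {..n} (\<lambda>i. real i / n)"
    using n by (auto simp: strict_mono_on_def divide_strict_right_mono)
  then have indep: "indep_vars (\<lambda>_. borel) X {..<n}"
    using W unfolding brownian_law_def X_def[abs_def] by (auto elim!: allE[of _ n] allE[of _ "\<lambda>i. real i / n"])
  have "distributed M lborel (X i) (\<lambda>z. ennreal (\<Prod>j\<in>UNIV. normal_density 0 (sqrt (real (Suc i) / n - real i / n)) (z $ j)))" for i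
    using W n unfolding brownian_law_def X_def[abs_def] by (auto simp: divide_strict_right_mono)
  moreover have "real (Suc i) / n - real i / n = 1 / n" for i
    by (simp add: diff_divide_distrib[symmetric])
  ultimately have X: "distributed M lborel (X i) (\<lambda>z. ennreal (\<Prod>j\<in>UNIV. normal_density 0 (sqrt (1 / n)) (z $ j)))" for i
    by simp
  have rv [measurable]: "X i \<in> borel_measurable M" for i
    using distributed_measurable[OF X] by simp
  have dist: "distr M borel (X i) = gauss_vec (1 / n)" for i
    using distributed_distr_eq_density[OF X] unfolding gauss_vec_def by (simp add: distr_cong[where N=lborel and M=M, OF refl sets_lborel])
  have sets: "sets (Pi\<^sub>M {..<n} (\<lambda>_. borel)) = sets (Pi\<^sub>M {..<n} (\<lambda>_. gauss_vec (1 / n) :: (real ^ 'n) measure))"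
    by (intro sets_PiM_cong) auto
  have inc: "increments n = (\<lambda>w. \<lambda>i\<in>{..<n}. X i w)"
    by (simp add: increments_def[abs_def] X_def)
  have "increments n \<in> M \<rightarrow>\<^sub>M Pi\<^sub>M {..<n} (\<lambda>_. borel)"
    unfolding inc by measurable
  then show ?meas
    using measurable_cong_sets[OF refl sets] by blast
  have "distr M (Pi\<^sub>M {..<n} (\<lambda>_. borel)) (increments n) = Pi\<^sub>M {..<n} (\<lambda>i. distr M borel (X i))"
    unfolding inc using indep n by (subst indep_vars_iff_distr_eq_PiM[symmetric]) auto
  then show ?distr
    unfolding dist using distr_cong[OF refl sets, of M "increments n" "increments n"] by simp
qed

lemma measure_increments:
  assumes W: "brownian_law x M" and n: "n > 0"
    and A: "A \<in> sets (Pi\<^sub>M {..<n} (\<lambda>_. gauss_vec (1 / n)))"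
    and le: "emeasure (Pi\<^sub>M {..<n} (\<lambda>_. gauss_vec (1 / n))) A \<le> ennreal b" "b \<ge> 0"
  shows "increments n -` A \<inter> space M \<in> sets M" "measure M (increments n -` A \<inter> space M) \<le> b"
proof -
  interpret prob_space M using W by (simp add: brownian_law_def)
  show "increments n -` A \<inter> space M \<in> sets M"
    using measurable_sets[OF measurable_increments[OF W n] A] .
  have "emeasure M (increments n -` A \<inter> space M) = emeasure (Pi\<^sub>M {..<n} (\<lambda>_. gauss_vec (1 / n))) A"
    using emeasure_distr[OF measurable_increments[OF W n] A] unfolding distr_increments[OF W n] by simp
  with le show "measure M (increments n -` A \<inter> space M) \<le> b"
    by (metis emeasure_eq_measure ennreal_le_iff)
qed

lemma brownian_law_space: "brownian_law x M \<Longrightarrow> space M = path_space"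
  using sets_eq_imp_space_eq[of M path_borel]
  by (simp add: brownian_law_def path_borel_def space_measure_of_conv)

lemma exit_time_le: "0 < t \<Longrightarrow> w t \<notin> U \<Longrightarrow> exit_time U w \<le> ereal t"
  unfolding exit_time_def by (intro Inf_lower) auto

lemma exit_time_lessD: "exit_time U w < ereal r \<Longrightarrow> \<exists>t. 0 < t \<and> t < r \<and> w t \<notin> U"
  unfolding exit_time_def Inf_less_iff by auto

lemma norm_minus_axis_square:
  fixes y :: "real ^ 'n"
  shows "(norm (y - axis k 1))\<^sup>2 = (norm y)\<^sup>2 - 2 * y $ k + 1"
  unfolding power2_norm_eq_inner by (simp add: inner_diff_left inner_diff_right inner_axis inner_axis' inner_axis_axis)

section \<open>Upper and lower estimates for the two path events\<close>

lemma measure_exit_ball_le: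
  fixes M :: "(real \<Rightarrow> real ^ 'n) measure" and l :: real
  assumes W: "brownian_law (l *\<^sub>R axis k 1) M" and l: "0 < l" and s: "0 < s" "s < 1 / 4"
  shows "measure M {w \<in> space M. exit_time (ball (axis k 1) 1) w \<le> ereal s \<and> exit_time {x. x $ k > 0} w > 1}
    \<le> 2 * l\<^sup>2 + 4 * CARD('n) * l * sqrt (2 * s)" (is "measure M ?A \<le> _")
proof -
  interpret prob_space M using W by (simp add: brownian_law_def)
  let ?d = "real CARD('n)"
  let ?x = "l *\<^sub>R axis k 1 :: real ^ 'n"
  let ?P = "\<lambda>p. Pi\<^sub>M {..<2 ^ p} (\<lambda>_. gauss_vec (1 / 2 ^ p) :: (real ^ 'n) measure)"
  have x: "?x $ k = l" "norm ?x = l" using l by (auto simp: norm_axis_1)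
  \<comment> \<open>An infimum of at most \<open>s\<close> provides times outside the ball only
    below each larger bound, hence the horizon \<open>2 * s\<close>. The assumption
    \<open>s < 1 / 4\<close> makes it at most half of the unit time.\<close>
  define m where "m p = nat \<lfloor>2 * s * 2 ^ p\<rfloor>" for p :: nat
  define E where "E p = {\<omega> \<in> space (?P p). fst (chain k (m p) ?x (2 ^ p) \<omega>) $ k > 0 \<and> snd (chain k (m p) ?x (2 ^ p) \<omega>)}" for p
  have E: "E p \<in> sets (?P p)" for p
  proof -
    have [measurable]: "chain k (m p) ?x (2 ^ p) \<in> ?P p \<rightarrow>\<^sub>M chain_space"
      by (rule measurable_chain) simp
    show ?thesis unfolding E_def by measurable
  qed
  have mn: "2 * m p \<le> 2 ^ p" and ms: "m p * (1 / 2 ^ p) \<le> 2 * s" for p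
  proof -
    have "real (m p) \<le> 2 * s * 2 ^ p" using s unfolding m_def by (simp add: of_nat_nat)
    moreover from this show "m p * (1 / 2 ^ p) \<le> 2 * s" by (simp add: divide_le_eq)
    moreover have "2 * s * 2 ^ p \<le> 1 / 2 * 2 ^ p" using s by (intro mult_right_mono) auto
    ultimately have "real (m p) \<le> 1 / 2 * 2 ^ p" by linarith
    then have "real (2 * m p) \<le> real (2 ^ p)" by simp
    then show "2 * m p \<le> 2 ^ p" by (simp only: of_nat_le_iff)
  qed
  have conv: "\<forall>\<^sub>F p in sequentially. increments (2 ^ p) w \<in> E p"
    if w: "w \<in> ?A" "w 0 = ?x" for w
  proof -
    from w(1) have "w \<in> path_space" by (simp add: brownian_law_space[OF W])
    then have cont: "continuous_on {0..} w" by (simp add: path_space_def)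
    have "exit_time (ball (axis k 1) 1) w \<le> ereal s" using w by simp
    also have "ereal s < ereal (2 * s)" using s by simp
    finally obtain t where t: "0 < t" "t < 2 * s" "w t \<notin> ball (axis k 1) 1"
      using exit_time_lessD by blast
    have pos: "w r $ k > 0" if "0 \<le> r" "r \<le> 1" for r
    proof (rule ccontr)
      assume r: "\<not> w r $ k > 0"
      then have "r \<noteq> 0" using w x l by auto
      then have "exit_time {x. x $ k > 0} w \<le> ereal r" using r that by (intro exit_time_le) auto
      also have "ereal r \<le> 1" using that by simp
      finally show False using w(1) by (auto dest: leD)
    qed
    \<comment> \<open>Outside the ball \<open>2 * w t $ k \<le> (norm (w t))\<^sup>2\<close>. Since
      \<open>w t $ k > 0\<close>, dropping the factor 2 gives a strict inequality, an open condition
      that passes to nearby dyadic times.\<close>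
    have "1 \<le> (norm (w t - axis k 1))\<^sup>2"
      using t by (simp add: dist_norm norm_minus_commute one_le_power)
    then have "w t $ k < (norm (w t))\<^sup>2"
      using pos[of t] t s by (simp add: norm_minus_axis_square)
    moreover define j where "j p = nat \<lfloor>t * 2 ^ p\<rfloor>" for p :: nat
    have lim: "(\<lambda>p. w (real (j p) / 2 ^ p)) \<longlonglongrightarrow> w t"
      unfolding j_def using t
      by (intro continuous_on_tendsto_compose[OF cont dyadic_floor_tendsto]) auto
    ultimately have "\<forall>\<^sub>F p in sequentially. 0 < (norm (w (real (j p) / 2 ^ p)))\<^sup>2 - w (real (j p) / 2 ^ p) $ k"
      by (intro order_tendstoD(1)[where y="(norm (w t))\<^sup>2 - w t $ k"] tendsto_intros) auto
    \<comment> \<open>The flag is not tested at time 0, so the dyadic index must be at least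
      1.\<close>
    moreover have "\<forall>\<^sub>F p in sequentially. 0 < real (j p) / 2 ^ p"
      using order_tendstoD(1)[OF dyadic_floor_tendsto[of t], of 0] t by (simp add: j_def)
    ultimately show ?thesis
    proof eventually_elim
      case (elim p)
      have "t * 2 ^ p \<le> 2 * s * 2 ^ p" using t by (intro mult_right_mono) auto
      then have jm: "j p \<le> m p" unfolding j_def m_def by (intro nat_mono floor_mono)
      with mn[of p] have jn: "j p \<le> 2 ^ p" by simp
      have j1: "1 \<le> j p" using elim(2) by (simp add: zero_less_divide_iff Suc_le_eq)
      have walk: "walk ?x i (increments (2 ^ p) w) = w (real i / 2 ^ p)" if "i \<le> 2 ^ p" for i
        using walk_increments[OF that, of ?x w] w by simp
      have "w (real i / 2 ^ p) $ k > 0" if "i \<le> 2 ^ p" for i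
      proof (rule pos)
        have "real i \<le> real (2 ^ p)" using that by (simp only: of_nat_le_iff)
        then show "real i / 2 ^ p \<le> 1" by simp
      qed simp
      then have chain: "chain k (m p) ?x (2 ^ p) (increments (2 ^ p) w)
          = (w 1, \<exists>i\<in>{1..2 ^ p}. i \<le> m p \<and> walk ?x i (increments (2 ^ p) w) $ k < (norm (walk ?x i (increments (2 ^ p) w)))\<^sup>2)"
        using walk by (subst chain_eq_walk) auto
      have "\<exists>i\<in>{1..2 ^ p}. i \<le> m p \<and> walk ?x i (increments (2 ^ p) w) $ k < (norm (walk ?x i (increments (2 ^ p) w)))\<^sup>2"
        using elim jm jn j1 by (intro bexI[of _ "j p"]) (auto simp: walk)
      moreover have "increments (2 ^ p) w \<in> space (?P p)"
        using measurable_space[OF measurable_increments[OF W, of "2 ^ p"]] w by simp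
      ultimately show ?case
        using pos[of 1] by (simp add: E_def chain)
    qed
  qed
  \<comment> \<open>The order of limits matters: the mesh tends to 0 with \<delta> fixed, which
    removes the terms in \<open>h / \<delta> ^ 4\<close>, and only afterwards does \<delta> tend to
    0.\<close>
  have bound: "prob ?A \<le> 2 * l\<^sup>2 + 2 * \<delta> + 4 * ?d * (l + \<delta>) * sqrt (2 * s)" if \<delta>: "\<delta> > 0" for \<delta>
  proof (rule measure_le_of_AE_eventually[where E = "\<lambda>p. increments (2 ^ p) -` E p \<inter> space M"
        and b = "\<lambda>p. 2 * l\<^sup>2 + (2 * \<delta> + 3 * (1 / 2) ^ p / \<delta> ^ 4)
          + 2 * ?d * ((1 / 2) ^ p + 2 * (l + \<delta>) * sqrt (2 * s) + 3 * (1 / 2) ^ p / \<delta> ^ 4)"])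
    have "AE w in M. w 0 = ?x" using W by (simp add: brownian_law_def)
    then show "AE w in M. w \<in> ?A \<longrightarrow> (\<forall>\<^sub>F p in sequentially. w \<in> increments (2 ^ p) -` E p \<inter> space M)"
      by eventually_elim (use conv in auto)
    show "(\<lambda>p. 2 * l\<^sup>2 + (2 * \<delta> + 3 * (1 / 2) ^ p / \<delta> ^ 4)
          + 2 * ?d * ((1 / 2) ^ p + 2 * (l + \<delta>) * sqrt (2 * s) + 3 * (1 / 2) ^ p / \<delta> ^ 4))
        \<longlonglongrightarrow> 2 * l\<^sup>2 + 2 * \<delta> + 4 * ?d * (l + \<delta>) * sqrt (2 * s)"
      (is "?b \<longlonglongrightarrow> ?c")
    proof -
      have "?b \<longlonglongrightarrow> 2 * l\<^sup>2 + (2 * \<delta> + 3 * 0 / \<delta> ^ 4) + 2 * ?d * (0 + 2 * (l + \<delta>) * sqrt (2 * s) + 3 * 0 / \<delta> ^ 4)"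
        using \<delta> by (intro tendsto_intros LIMSEQ_realpow_zero) auto
      also have "2 * l\<^sup>2 + (2 * \<delta> + 3 * 0 / \<delta> ^ 4) + 2 * ?d * (0 + 2 * (l + \<delta>) * sqrt (2 * s) + 3 * 0 / \<delta> ^ 4) = ?c"
        by (simp add: algebra_simps)
      finally show ?thesis .
    qed
    fix p :: nat
    let ?b = "2 * l\<^sup>2 + (2 * \<delta> + 3 * (1 / 2) ^ p / \<delta> ^ 4)
          + 2 * ?d * ((1 / 2) ^ p + 2 * (l + \<delta>) * sqrt (2 * s) + 3 * (1 / 2) ^ p / \<delta> ^ 4)"
    have h: "1 / real (2 ^ p) = (1 / 2) ^ p" by (simp add: power_one_over)
    have "(\<Sum>i<m p. (1 / 2) ^ p * walk_survival ((1 / 2) ^ p) \<delta> i l)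
        \<le> (1 / 2) ^ p + 2 * (l + \<delta>) * sqrt (2 * s) + 3 * (1 / 2) ^ p / \<delta> ^ 4"
      using mn[of p] ms[of p] l \<delta> by (intro sum_walk_survival_le[of "2 ^ p"]) (auto simp: power_one_over)
    then have "2 * ?d * (\<Sum>i<m p. (1 / 2) ^ p * walk_survival ((1 / 2) ^ p) \<delta> i l)
        \<le> 2 * ?d * ((1 / 2) ^ p + 2 * (l + \<delta>) * sqrt (2 * s) + 3 * (1 / 2) ^ p / \<delta> ^ 4)"
      by (intro mult_left_mono) auto
    then have le: "2 * (norm ?x)\<^sup>2 + (2 * \<delta> + 3 * (1 / 2) ^ p / \<delta> ^ 4)
        + (\<Sum>i<m p. 2 * CARD('n) * (1 / 2) ^ p * walk_survival ((1 / 2) ^ p) \<delta> i (?x $ k)) \<le> ?b"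
      unfolding x by (simp add: sum_distrib_left mult.assoc)
    have "emeasure (?P p) (E p) \<le> ennreal (2 * (norm ?x)\<^sup>2 + (2 * \<delta> + 3 * (1 / 2) ^ p / \<delta> ^ 4)
        + (\<Sum>i<m p. 2 * CARD('n) * (1 / 2) ^ p * walk_survival ((1 / 2) ^ p) \<delta> i (?x $ k)))"
      using chain_bad_le[of "2 ^ p" "m p" ?x k \<delta> "(1 / 2) ^ p" "2 * \<delta> + 3 * (1 / 2) ^ p / \<delta> ^ 4"] mn[of p] l \<delta>
      unfolding E_def by (simp add: power_one_over)
    also have "\<dots> \<le> ennreal ?b" by (intro ennreal_leI le)
    finally have "emeasure (?P p) (E p) \<le> ennreal ?b" .
    moreover have "?b \<ge> 0" using l \<delta> s by (auto intro!: add_nonneg_nonneg mult_nonneg_nonneg)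
    ultimately show "increments (2 ^ p) -` E p \<inter> space M \<in> sets M" "prob (increments (2 ^ p) -` E p \<inter> space M) \<le> ?b"
      using measure_increments[OF W, of "2 ^ p" "E p" ?b] E[of p] by auto
  qed
  have "((\<lambda>\<delta>. 2 * l\<^sup>2 + 2 * \<delta> + 4 * ?d * (l + \<delta>) * sqrt (2 * s)) \<longlongrightarrow> 2 * l\<^sup>2 + 2 * 0 + 4 * ?d * (l + 0) * sqrt (2 * s)) (at_right 0)"
    by (intro tendsto_intros)
  then have "prob ?A \<le> 2 * l\<^sup>2 + 2 * 0 + 4 * ?d * (l + 0) * sqrt (2 * s)"
    by (rule tendsto_lowerbound) (auto simp: eventually_at_right_less intro: eventually_mono[OF eventually_at_right_less] bound)
  then show ?thesis by simp
qed

text \<open>A path may leave the half-space by merely touching the boundary, which sampling can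
  miss. The walk is therefore started at \<open>l / 2\<close>, so that it is the path lowered by
  \<open>l / 2\<close> and the exit becomes a strict crossing. Then \<open>survival_1_ge\<close> at
  \<open>l / 2\<close> gives \<open>l / 8\<close>.\<close>

lemma measure_survive_half_space_ge:
  fixes M :: "(real \<Rightarrow> real ^ 'n) measure" and l :: real
  assumes W: "brownian_law (l *\<^sub>R axis k 1) M" and l: "0 < l" "l \<le> 1"
    and Q: "{w \<in> space M. exit_time {x. x $ k > 0} w > 1} \<in> sets M" (is "?Q \<in> _")
  shows "measure M {w \<in> space M. exit_time {x. x $ k > 0} w > 1} \<ge> l / 8"
proof -
  interpret prob_space M using W by (simp add: brownian_law_def)
  let ?x = "(l / 2) *\<^sub>R axis k 1 :: real ^ 'n"
  let ?P = "\<lambda>p. Pi\<^sub>M {..<2 ^ p} (\<lambda>_. gauss_vec (1 / 2 ^ p) :: (real ^ 'n) measure)"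
  define E where "E p = {\<omega> \<in> space (?P p). fst (chain k 0 ?x (2 ^ p) \<omega>) $ k \<le> 0}" for p
  have E: "E p \<in> sets (?P p)" for p
  proof -
    have [measurable]: "chain k 0 ?x (2 ^ p) \<in> ?P p \<rightarrow>\<^sub>M chain_space"
      by (rule measurable_chain) simp
    show ?thesis unfolding E_def by measurable
  qed
  have conv: "\<forall>\<^sub>F p in sequentially. increments (2 ^ p) w \<in> E p"
    if w: "w \<in> space M - ?Q" "w 0 = l *\<^sub>R axis k 1" for w
  proof -
    from w(1) have "w \<in> path_space" by (simp add: brownian_law_space[OF W])
    then have cont: "continuous_on {0..} w" by (simp add: path_space_def)
    \<comment> \<open>Exit time at most 1 only yields exits before \<open>1 + \<eta>\<close>. If the
      path is at height at least \<open>l / 2\<close> at time 1, continuity keeps it positive near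
      1, so for small \<eta> the exit occurs before 1.\<close>
    have "\<exists>t. 0 < t \<and> t \<le> 1 \<and> w t $ k < l / 2"
    proof (cases "w 1 $ k < l / 2")
      case False
      have "((\<lambda>r. w r $ k) \<longlongrightarrow> w 1 $ k) (at 1 within {0..})"
        using cont by (intro tendsto_intros) (auto simp: continuous_on_def)
      then have "\<forall>\<^sub>F r in at 1 within {0..}. w r $ k > 0"
        using False l by (intro order_tendstoD(1)[where y="w 1 $ k"]) auto
      then obtain \<eta> where \<eta>: "\<eta> > 0" "\<And>r. r \<ge> 0 \<Longrightarrow> r \<noteq> 1 \<Longrightarrow> dist r 1 < \<eta> \<Longrightarrow> w r $ k > 0"
        unfolding eventually_at by auto
      have "exit_time {x. x $ k > 0} w \<le> 1" using w by auto
      also have "(1::ereal) < ereal (1 + \<eta>)" using \<eta> by simp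
      finally obtain t where t: "0 < t" "t < 1 + \<eta>" "w t $ k \<le> 0"
        using exit_time_lessD[of "{x. x $ k > 0}" w "1 + \<eta>"] by auto
      then have "t \<le> 1" using \<eta>(2)[of t] by (force simp: dist_real_def)
      with t l show ?thesis by (intro exI[of _ t]) auto
    qed (auto intro!: exI[of _ 1])
    then obtain t where t: "0 < t" "t \<le> 1" "w t $ k < l / 2" by auto
    define j where "j p = nat \<lfloor>t * 2 ^ p\<rfloor>" for p :: nat
    have lim: "(\<lambda>p. w (real (j p) / 2 ^ p)) \<longlonglongrightarrow> w t"
      unfolding j_def using t
      by (intro continuous_on_tendsto_compose[OF cont dyadic_floor_tendsto]) auto
    have "\<forall>\<^sub>F p in sequentially. w (real (j p) / 2 ^ p) $ k < l / 2"
      using t by (intro order_tendstoD(2)[OF tendsto_vec_nth[OF lim]])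
    then show ?thesis
    proof eventually_elim
      case (elim p)
      have "t * 2 ^ p \<le> 1 * 2 ^ p" using t by (intro mult_right_mono) auto
      then have "\<lfloor>t * 2 ^ p\<rfloor> \<le> \<lfloor>real (2 ^ p)\<rfloor>" by (intro floor_mono) simp
      then have jn: "j p \<le> 2 ^ p" unfolding j_def by (simp add: nat_le_iff)
      have "walk ?x (j p) (increments (2 ^ p) w) $ k \<le> 0"
        using walk_increments[OF jn, of ?x w] w elim by simp
      then have "fst (chain k 0 ?x (2 ^ p) (increments (2 ^ p) w)) $ k \<le> 0"
        by (rule chain_dead[OF jn])
      moreover have "increments (2 ^ p) w \<in> space (?P p)"
        using measurable_space[OF measurable_increments[OF W, of "2 ^ p"]] w by simp
      ultimately show ?case by (simp add: E_def)
    qed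
  qed
  have "prob (space M - ?Q) \<le> 1 - survival 1 (l / 2)"
  proof (rule measure_le_of_AE_eventually[where E = "\<lambda>p. increments (2 ^ p) -` E p \<inter> space M"])
    have "AE w in M. w 0 = l *\<^sub>R axis k 1" using W by (simp add: brownian_law_def)
    then show "AE w in M. w \<in> space M - ?Q \<longrightarrow> (\<forall>\<^sub>F p in sequentially. w \<in> increments (2 ^ p) -` E p \<inter> space M)"
      by eventually_elim (use conv in auto)
    fix p :: nat
    have "emeasure (?P p) (E p) \<le> ennreal (1 - survival 1 (l / 2))"
      using chain_dead_le[of "1 / 2 ^ p" ?x k "2 ^ p" 0] l unfolding E_def by simp
    moreover have "1 - survival 1 (l / 2) \<ge> 0" using abs_survival_le_1[of 1 "l / 2"] by simp
    ultimately show "increments (2 ^ p) -` E p \<inter> space M \<in> sets M"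
      "prob (increments (2 ^ p) -` E p \<inter> space M) \<le> 1 - survival 1 (l / 2)"
      using measure_increments[OF W, of "2 ^ p" "E p"] E[of p] by auto
  qed simp
  then have "survival 1 (l / 2) \<le> prob ?Q"
    using prob_compl[OF Q] by simp
  moreover have "l / 2 / 4 \<le> survival 1 (l / 2)" using l by (intro survival_1_ge) auto
  ultimately show ?thesis by simp
qed

section \<open>The conditional probability and the iterated limit\<close>

theorem lemma4p3:
  fixes W :: "real ^ 'n \<Rightarrow> (real \<Rightarrow> real ^ 'n) measure"
    and k :: 'n
    and D B :: "(real ^ 'n) set"
    and e\<^sub>1 :: "real ^ 'n"
  assumes "CARD('n) \<ge> 2"
    and "\<And>x. brownian_law x (W x)"
    and "D = {x. x $ k > 0}"
    and "e\<^sub>1 = axis k 1"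
    and "B = ball e\<^sub>1 1"
  shows "((\<lambda>s. Limsup (at_right 0)
            (\<lambda>l. ereal (cond_law W D (l *\<^sub>R e\<^sub>1) {w \<in> path_space. exit_time B w \<le> ereal s})))
          \<longlongrightarrow> 0) (at_right 0)"
proof -
  let ?d = "real CARD('n)"
  let ?f = "\<lambda>s l. cond_law W D (l *\<^sub>R e\<^sub>1) {w \<in> path_space. exit_time B w \<le> ereal s}"
  have nonneg: "0 \<le> ?f s l" for s l
    by (simp add: cond_law_def cond_prob_def)
  \<comment> \<open>The factor \<open>l\<close> in the bound for the joint event cancels against the
    survival probability \<open>l / 8\<close>.\<close>
  have le: "?f s l \<le> 16 * l + 32 * ?d * sqrt (2 * s)" if s: "0 < s" "s < 1 / 4" and l: "0 < l" "l \<le> 1" for s l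
  proof -
    let ?M = "W (l *\<^sub>R e\<^sub>1)"
    have W: "brownian_law (l *\<^sub>R axis k 1) ?M" using assms by auto
    let ?Q = "{w \<in> space ?M. exit_time D w > 1}"
    let ?A = "{w \<in> space ?M. exit_time B w \<le> ereal s \<and> exit_time D w > 1}"
    have f: "?f s l = measure ?M ?A / measure ?M ?Q"
      unfolding cond_law_def cond_prob_def by (simp add: brownian_law_space[OF W] cong: conj_cong)
    show ?thesis
    proof (cases "?Q \<in> sets ?M")
      case False
      \<comment> \<open>a non-measurable set has measure 0, and \<open>x / 0 = 0\<close>\<close>
      then have "?f s l = 0" unfolding f by (simp add: measure_notin_sets)
      then show ?thesis using s l by simp
    next
      case True
      have "measure ?M ?A \<le> 2 * l\<^sup>2 + 4 * ?d * l * sqrt (2 * s)"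
        using measure_exit_ball_le[OF W l(1) s] assms by simp
      moreover have "l / 8 \<le> measure ?M ?Q"
        using measure_survive_half_space_ge[OF W l] True assms by simp
      ultimately have "?f s l \<le> (2 * l\<^sup>2 + 4 * ?d * l * sqrt (2 * s)) / (l / 8)"
        unfolding f using s l by (intro frac_le) auto
      also have "\<dots> = 16 * l + 32 * ?d * sqrt (2 * s)"
        using l by (simp add: field_simps power2_eq_square)
      finally show ?thesis .
    qed
  qed
  have lower: "0 \<le> Limsup (at_right 0) (\<lambda>l. ereal (?f s l))" for s
    using nonneg by (intro le_Limsup) auto
  \<comment> \<open>The term \<open>16 * l\<close> disappears in the inner limit; the remaining
    bound is of order \<open>sqrt s\<close> and disappears in the outer one.\<close>
  have upper: "Limsup (at_right 0) (\<lambda>l. ereal (?f s l)) \<le> ereal (32 * ?d * sqrt (2 * s))"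
    if s: "0 < s" "s < 1 / 4" for s
  proof -
    have "\<forall>\<^sub>F l::real in at_right 0. l \<in> {0<..<1}"
      by (rule eventually_at_right_real) simp
    then have "Limsup (at_right 0) (\<lambda>l. ereal (?f s l)) \<le> Limsup (at_right 0) (\<lambda>l. ereal (16 * l + 32 * ?d * sqrt (2 * s)))"
      by (intro Limsup_mono) (auto elim!: eventually_mono intro!: le[OF s])
    also have "((\<lambda>l. 16 * l + 32 * ?d * sqrt (2 * s)) \<longlongrightarrow> 16 * 0 + 32 * ?d * sqrt (2 * s)) (at_right 0)"
      by (intro tendsto_intros)
    then have "Limsup (at_right 0) (\<lambda>l. ereal (16 * l + 32 * ?d * sqrt (2 * s))) = ereal (32 * ?d * sqrt (2 * s))"
      by (intro lim_imp_Limsup) auto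
    finally show ?thesis .
  qed
  show ?thesis
  proof (rule tendsto_sandwich[of "\<lambda>_. 0" _ _ "\<lambda>s. ereal (32 * ?d * sqrt (2 * s))"])
    show "\<forall>\<^sub>F s in at_right 0. 0 \<le> Limsup (at_right 0) (\<lambda>l. ereal (?f s l))"
      using lower by (intro always_eventually) auto
    have "\<forall>\<^sub>F s::real in at_right 0. s \<in> {0<..<1 / 4}"
      by (rule eventually_at_right_real) simp
    then show "\<forall>\<^sub>F s in at_right 0. Limsup (at_right 0) (\<lambda>l. ereal (?f s l)) \<le> ereal (32 * ?d * sqrt (2 * s))"
      by (rule eventually_mono) (auto intro: upper)
    have "((\<lambda>s. 32 * ?d * sqrt (2 * s)) \<longlongrightarrow> 32 * ?d * sqrt (2 * 0)) (at_right 0)"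
      by (intro tendsto_intros)
    then show "((\<lambda>s. ereal (32 * ?d * sqrt (2 * s))) \<longlongrightarrow> 0) (at_right 0)"
      by (simp add: zero_ereal_def)
  qed simp
qed

end
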